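(* Let $N$ be a ground set with $n=|N|$ (with $\sqrt n$ an integer) and let $1\le k\le n$. Let $\mathcal D^{sub}$ be the distribution on $2^N$ which, with probability $1/3$ each, draws a uniformly random subset of $N$ of size $k$, of size $\sqrt n$, or of size $\sqrt n+1$. Consider the following algorithm, given polynomially many (sufficiently many) samples $(S_i,f(S_i))$ with $S_i$ drawn i.i.d. from $\mathcal D^{sub}$. With probability $1/2$ it returns the sample of size $k$ with largest value. With probability $1/2$ it computes, for each $e_i\in N$, $\hat v_i=\frac{1}{|\mathcal S_{i,\sqrt n+1}|}\sum_{S\in\mathcal S_{i,\sqrt n+1}}f(S)-\frac{1}{|\mathcal S_{-i,\sqrt n}|}\sum_{S\in\mathcal S_{-i,\sqrt n}}f(S)$, where $\mathcal S_{i,j}$ (resp. $\mathcal S_{-i,j}$) is the collection of samples of size $j$ containing (resp. not containing) $e_i$; sets $\hat v_{\max}=\max_i\hat v_i$; forms bins $B_j=\{e_i:\hat v_{\max}/2^{j}<\hat v_i\le \hat v_{\max}/2^{j-1}\}$ for $j\in[3\log n]$; picks $j\in[3\log n]$ uniformly at random; and returns a uniformly random subset of $B_j$ of size $\min\{|B_j|,k\}$. Then this algorithm is an $\tilde\Omega(n^{-1/4})$-OPS algorithm over $\mathcal D^{sub}$ for monotone submodular functions, i.e., for every monotone submodular $f:2^N\to\mathbb R$, with probability at least $1-\delta$ over the samples (for a constant $\delta\in[0,1)$), the returned set $S$ satisfies $|S|\le k$ and $\mathbb E[f(S)]\ge \frac{n^{-1/4}}{\mathrm{polylog}(n)}\max_{T:|T|\le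 k}f(T)$, the expectation being over the algorithm's randomness.
   Context: A function $f:2^N\to\mathbb R$ is monotone if $f(S\cup\{e\})-f(S)\ge0$ for all $S,e$, and submodular if $f(S\cup\{e\})-f(S)\ge f(T\cup\{e\})-f(T)$ for all $S\subseteq T\subseteq N$, $e\in N$. $\tilde\Omega(n^{-1/4})$ denotes $\Omega(n^{-1/4})$ up to polylogarithmic factors in $n$. The number of samples is polynomial in $n$.
   Formalization: The function f is additionally assumed nonnegative (the claim fails for the constant function f = -1), and the constant δ ranges over (0,1), excluding δ = 0, where the claim fails. *)

theory Defs
  imports "HOL-Probability.Probability"
begin

definition monotone_sf :: "nat set \<Rightarrow> (nat set \<Rightarrow> real) \<Rightarrow> bool" where
  "monotone_sf N f \<longleftrightarrow> (\<forall>S e. S \<subseteq> N \<longrightarrow> e \<in> N \<longrightarrow> f (S \<union> {e}) - f S \<ge> 0)"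

definition submodular_sf :: "nat set \<Rightarrow> (nat set \<Rightarrow> real) \<Rightarrow> bool" where
  "submodular_sf N f \<longleftrightarrow> (\<forall>S T e. S \<subseteq> T \<longrightarrow> T \<subseteq> N \<longrightarrow> e \<in> N \<longrightarrow>
      f (S \<union> {e}) - f S \<ge> f (T \<union> {e}) - f T)"

definition unif_size :: "nat set \<Rightarrow> nat \<Rightarrow> nat set pmf" where
  "unif_size N s = pmf_of_set {S. S \<subseteq> N \<and> card S = s}"

text \<open>D^sub: with probability 1/3 each, a uniform subset of size k, sqrt n, sqrt n + 1
  (here r = sqrt n). Indices 0,1,2 are used so that coinciding sizes still get weight 1/3 each.\<close>
definition D_sub :: "nat \<Rightarrow> nat \<Rightarrow> nat \<Rightarrow> nat set pmf" where
  "D_sub n r k = pmf_of_set {0::nat, 1, 2} \<bind>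
     (\<lambda>t. unif_size {..<n} (if t = 0 then k else if t = 1 then r else r + 1))"

definition mean_list :: "real list \<Rightarrow> real" where
  "mean_list xs = sum_list xs / real (length xs)"

definition best_k_sample :: "nat \<Rightarrow> (nat set \<times> real) list \<Rightarrow> nat set" where
  "best_k_sample k xs =
     (let K = filter (\<lambda>p. card (fst p) = k) xs in
      if K = [] then {} else
        fst (hd (filter (\<lambda>p. snd p = Max (snd ` set K)) K)))"

definition v_hat :: "nat \<Rightarrow> (nat set \<times> real) list \<Rightarrow> nat \<Rightarrow> real" where
  "v_hat r xs i =
     mean_list (map snd (filter (\<lambda>p. card (fst p) = r + 1 \<and> i \<in> fst p) xs))
   - mean_list (map snd (filter (\<lambda>p. card (fst p) = r \<and> i \<notin> fst p) xs))"

definition num_bins :: "nat \<Rightarrow> nat" where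
  "num_bins n = nat \<lceil>3 * log 2 (real n)\<rceil>"

definition bin :: "nat \<Rightarrow> nat \<Rightarrow> (nat set \<times> real) list \<Rightarrow> nat \<Rightarrow> nat set" where
  "bin n r xs j =
     (let vmax = Max ((v_hat r xs) ` {..<n}) in
      {i \<in> {..<n}. vmax / 2 ^ j < v_hat r xs i \<and> v_hat r xs i \<le> vmax / 2 ^ (j - 1)})"

definition bin_branch :: "nat \<Rightarrow> nat \<Rightarrow> nat \<Rightarrow> (nat set \<times> real) list \<Rightarrow> nat set pmf" where
  "bin_branch n r k xs =
     (if num_bins n = 0 then return_pmf {} else
      pmf_of_set {1..num_bins n} \<bind>
        (\<lambda>j. pmf_of_set {T. T \<subseteq> bin n r xs j \<and> card T = min (card (bin n r xs j)) k}))"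

definition ALG :: "nat \<Rightarrow> nat \<Rightarrow> nat \<Rightarrow> (nat set \<times> real) list \<Rightarrow> nat set pmf" where
  "ALG n r k xs = bernoulli_pmf (1/2) \<bind>
     (\<lambda>b. if b then return_pmf (best_k_sample k xs) else bin_branch n r k xs)"

definition samples_pmf :: "nat \<Rightarrow> nat set pmf \<Rightarrow> (nat set \<Rightarrow> real) \<Rightarrow> (nat set \<times> real) list pmf" where
  "samples_pmf m D f =
     map_pmf (\<lambda>\<omega>. map (\<lambda>i. (\<omega> i, f (\<omega> i))) [0..<m]) (Pi_pmf {..<m} {} (\<lambda>_. D))"

definition OPT :: "nat \<Rightarrow> nat \<Rightarrow> (nat set \<Rightarrow> real) \<Rightarrow> real" where
  "OPT n k f = Max (f ` {T. T \<subseteq> {..<n} \<and> card T \<le> k})"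

end

theory Submission
  imports Defs
begin

text \<open>Let \<open>R\<close> be a uniformly random \<open>r\<close>-set, \<open>r = sqrt n\<close>, and let \<open>V\<close> be the optimum.

  If \<open>E f(R) > V/2\<close>, the best sample of size \<open>k\<close> suffices: the samples cover every element, so it has
  value at least \<open>max_i f({i}) \<ge> V/k\<close>, and it has at least about a third of the mean value of a \<open>k\<close>-set,
  which is at least \<open>min(1, k/r) V/2\<close>. One of these bounds is of order \<open>V / sqrt r\<close>.

  Otherwise the optimum keeps marginal value \<open>V/2\<close> over a typical \<open>R\<close>, so some bin \<open>B\<close> satisfies both
  \<open>f(B) \<ge> V/(4J)\<close> and \<open>v k \<ge> V/(32J)\<close>, where \<open>J\<close> is the number of bins and \<open>v\<close> bounds the marginals \<open>v_i\<close>
  of its elements from below. Let \<open>F\<close> be the mean of \<open>f\<close> over \<open>k\<close>-subsets of \<open>B\<close>, with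
  \<open>k < |B|\<close>. Submodularity gives \<open>F \<ge> (k/|B|) f(B)\<close>. Moreover a random \<open>(r+1)\<close>-set meets \<open>B\<close> in a random
  subset of about \<open>|B|/r\<close> elements whose value is at least about \<open>v |B|/r\<close>, whence
  \<open>|B| v \<le> F (r + |B|/k)\<close>. The two bounds on \<open>F\<close> balance at \<open>|B| = k sqrt r\<close>, which gives \<open>n^(-1/4)\<close>.\<close>

subsection \<open>Averages over subsets of a fixed size\<close>

abbreviation ksubsets :: "'a set \<Rightarrow> nat \<Rightarrow> 'a set set" where
  "ksubsets A s \<equiv> {X. X \<subseteq> A \<and> card X = s}"

definition avg :: "('a set \<Rightarrow> real) \<Rightarrow> 'a set \<Rightarrow> nat \<Rightarrow> real" where
  "avg f A s = (\<Sum>X\<in>ksubsets A s. f X) / real (card A choose s)"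

lemma finite_ksubsets: "finite A \<Longrightarrow> finite (ksubsets A s)"
  by (rule finite_subset[of _ "Pow A"]) auto

lemma ksubsets_nonempty:
  assumes "finite A" "s \<le> card A"
  shows "ksubsets A s \<noteq> {}"
proof -
  have "card (ksubsets A s) > 0"
    using assms by (simp add: n_subsets)
  then show ?thesis
    by (metis card.empty less_irrefl)
qed

lemma sum_ksubsets_eq_avg:
  assumes "finite A" "s \<le> card A"
  shows "(\<Sum>X\<in>ksubsets A s. f X) = avg f A s * real (card A choose s)"
  using assms by (simp add: avg_def)

text \<open>Deleting \<open>i\<close> is a bijection from the \<open>Suc s\<close>-subsets
  containing \<open>i\<close> onto the \<open>s\<close>-subsets avoiding \<open>i\<close>.\<close>

lemma sum_ksubsets_remove:
  assumes "finite A" "i \<in> A"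
  shows "(\<Sum>Y\<in>{Y \<in> ksubsets A (Suc s). i \<in> Y}. g (Y - {i})) = (\<Sum>X\<in>{X \<in> ksubsets A s. i \<notin> X}. g X)"
proof (rule sum.reindex_bij_witness[of _ "insert i" "\<lambda>Y. Y - {i}"])
  fix X assume "X \<in> {X \<in> ksubsets A s. i \<notin> X}"
  moreover from this have "finite X"
    using assms finite_subset by blast
  ultimately show "insert i X \<in> {Y \<in> ksubsets A (Suc s). i \<in> Y}"
    using assms by auto
qed (use assms in \<open>auto simp: insert_absorb\<close>)

lemma card_ksubsets_notin:
  assumes "finite A" "i \<in> A"
  shows "card {X \<in> ksubsets A s. i \<notin> X} = (card A - 1) choose s"
proof -
  have "{X \<in> ksubsets A s. i \<notin> X} = ksubsets (A - {i}) s"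
    by auto
  with assms show ?thesis
    by (simp add: n_subsets)
qed

lemma card_ksubsets_in:
  assumes "finite A" "i \<in> A"
  shows "card {Y \<in> ksubsets A (Suc s). i \<in> Y} = (card A - 1) choose s"
  using sum_ksubsets_remove[OF assms, of "\<lambda>_. 1::nat" s] card_ksubsets_notin[OF assms, of s]
  by simp

text \<open>Double counting: a given \<open>s\<close>-set \<open>X\<close> arises as
  \<open>Y - {i}\<close> once for each of the \<open>card A - s\<close> elements \<open>i\<close>
  outside \<open>X\<close>.\<close>

lemma sum_ksubsets_sum_remove:
  fixes g :: "'a set \<Rightarrow> real"
  assumes "finite A"
  shows "(\<Sum>Y\<in>ksubsets A (Suc s). \<Sum>i\<in>Y. g (Y - {i})) = real (card A - s) * (\<Sum>X\<in>ksubsets A s. g X)"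
proof -
  have "(\<Sum>Y\<in>ksubsets A (Suc s). \<Sum>i\<in>Y. g (Y - {i}))
      = (\<Sum>Y\<in>ksubsets A (Suc s). \<Sum>i\<in>{i \<in> A. i \<in> Y}. g (Y - {i}))"
    by (intro sum.cong) auto
  also have "\<dots> = (\<Sum>i\<in>A. \<Sum>Y\<in>{Y \<in> ksubsets A (Suc s). i \<in> Y}. g (Y - {i}))"
    by (rule sum.swap_restrict[OF finite_ksubsets[OF assms] assms])
  also have "\<dots> = (\<Sum>i\<in>A. \<Sum>X\<in>{X \<in> ksubsets A s. i \<notin> X}. g X)"
    using assms by (intro sum.cong refl sum_ksubsets_remove)
  also have "\<dots> = (\<Sum>X\<in>ksubsets A s. \<Sum>i\<in>{i \<in> A. i \<notin> X}. g X)"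
    by (rule sum.swap_restrict[OF assms finite_ksubsets[OF assms]])
  also have "\<dots> = (\<Sum>X\<in>ksubsets A s. real (card A - s) * g X)"
  proof (intro sum.cong refl)
    fix X assume "X \<in> ksubsets A s"
    then have "card {i \<in> A. i \<notin> X} = card A - s"
      using assms by (metis (mono_tags, lifting) card_Diff_subset finite_subset mem_Collect_eq set_diff_eq)
    then show "(\<Sum>i\<in>{i \<in> A. i \<notin> X}. g X) = real (card A - s) * g X"
      by simp
  qed
  finally show ?thesis
    by (simp add: sum_distrib_left)
qed

text \<open>Both sides depend on \<open>Y\<close> only through the trace \<open>Y \<inter> B\<close>, and the number of \<open>Y\<close> with a given
  trace depends only on the size of the trace; so it suffices to compare the averages level by level.\<close>

lemma sum_ksubsets_trace_le:
  fixes g g' :: "'a set \<Rightarrow> real"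
  assumes N: "finite N" "B \<subseteq> N"
    and le: "\<And>h. h \<le> card B \<Longrightarrow> (\<Sum>X\<in>ksubsets B h. g X) \<le> (\<Sum>X\<in>ksubsets B h. g' X)"
  shows "(\<Sum>Y\<in>ksubsets N s. g (Y \<inter> B)) \<le> (\<Sum>Y\<in>ksubsets N s. g' (Y \<inter> B))"
proof -
  have B: "finite B"
    using N finite_subset by blast
  \<comment> \<open>\<open>w h\<close> counts the \<open>s\<close>-sets with a prescribed trace of
    size \<open>h\<close>: their other \<open>s - h\<close> elements lie outside \<open>B\<close>.
    The case distinction guards against truncated subtraction, which would give 1 for
    \<open>h > s\<close>.\<close>
  define w where "w h = (if h \<le> s then (card N - card B) choose (s - h) else 0)" for h
  have card_trace: "card {Y \<in> ksubsets N s. Y \<inter> B = X} = w (card X)" if X: "X \<in> Pow B" for X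
  proof -
    have finX: "finite X"
      using X B finite_subset by blast
    have cardY: "card Y = card X + card (Y - B)" if "Y \<subseteq> N" "Y \<inter> B = X" for Y
      using that N card_Int_Diff[of Y B] finite_subset by auto
    show ?thesis
    proof (cases "card X \<le> s")
      case True
      have "bij_betw (\<lambda>Z. Z \<union> X) (ksubsets (N - B) (s - card X)) {Y \<in> ksubsets N s. Y \<inter> B = X}"
      proof (rule bij_betwI[of _ _ _ "\<lambda>Y. Y - B"])
        show "(\<lambda>Z. Z \<union> X) \<in> ksubsets (N - B) (s - card X) \<rightarrow> {Y \<in> ksubsets N s. Y \<inter> B = X}"
        proof
          fix Z assume Z: "Z \<in> ksubsets (N - B) (s - card X)"
          then have "card (Z \<union> X) = card Z + card X"
            using N X finX by (intro card_Un_disjoint) (auto intro: finite_subset)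
          with Z True X N show "Z \<union> X \<in> {Y \<in> ksubsets N s. Y \<inter> B = X}"
            by auto
        qed
        show "(\<lambda>Y. Y - B) \<in> {Y \<in> ksubsets N s. Y \<inter> B = X} \<rightarrow> ksubsets (N - B) (s - card X)"
          using cardY by fastforce
      qed (use X in auto)
      then have "card {Y \<in> ksubsets N s. Y \<inter> B = X} = card (ksubsets (N - B) (s - card X))"
        by (rule bij_betw_same_card[symmetric])
      also have "\<dots> = w (card X)"
        using True N B by (simp add: w_def n_subsets card_Diff_subset)
      finally show ?thesis .
    next
      case False
      then have empty: "{Y \<in> ksubsets N s. Y \<inter> B = X} = {}"
        using cardY by fastforce
      show ?thesis
        unfolding empty using False by (simp add: w_def)
    qed
  qed
  have trace: "(\<Sum>Y\<in>ksubsets N s. u (Y \<inter> B)) = (\<Sum>h\<le>card B. real (w h) * (\<Sum>X\<in>ksubsets B h. u X))"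
    for u :: "'a set \<Rightarrow> real"
  proof -
    have "(\<Sum>Y\<in>ksubsets N s. u (Y \<inter> B)) = (\<Sum>X\<in>Pow B. \<Sum>Y\<in>{Y \<in> ksubsets N s. Y \<inter> B = X}. u (Y \<inter> B))"
      using B finite_ksubsets[OF N(1)] by (intro sum.group[symmetric]) auto
    also have "\<dots> = (\<Sum>X\<in>Pow B. real (w (card X)) * u X)"
      using card_trace by (intro sum.cong refl) simp
    also have "\<dots> = (\<Sum>h\<le>card B. \<Sum>X\<in>{X \<in> Pow B. card X = h}. real (w (card X)) * u X)"
      using B by (intro sum.group[symmetric]) (auto intro: card_mono)
    also have "\<dots> = (\<Sum>h\<le>card B. real (w h) * (\<Sum>X\<in>ksubsets B h. u X))"
      by (intro sum.cong refl) (simp add: sum_distrib_left)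
    finally show ?thesis .
  qed
  show ?thesis
    unfolding trace by (rule sum_mono, rule mult_left_mono) (use le in auto)
qed

text \<open>Both sides count the pairs of a set \<open>Y\<close> and an element of
  \<open>Y \<inter> B\<close>.\<close>

lemma sum_card_inter_ksubsets:
  assumes "finite N" "B \<subseteq> N"
  shows "(\<Sum>Y\<in>ksubsets N (Suc s). card (Y \<inter> B)) = card B * ((card N - 1) choose s)"
proof -
  have B: "finite B"
    using assms finite_subset by blast
  have "(\<Sum>Y\<in>ksubsets N (Suc s). card (Y \<inter> B)) = (\<Sum>Y\<in>ksubsets N (Suc s). \<Sum>i\<in>{i \<in> B. i \<in> Y}. 1)"
    by (intro sum.cong) (auto simp: Int_def conj_commute)
  also have "\<dots> = (\<Sum>i\<in>B. \<Sum>Y\<in>{Y \<in> ksubsets N (Suc s). i \<in> Y}. 1)"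
    by (rule sum.swap_restrict[OF finite_ksubsets[OF assms(1)] B])
  also have "\<dots> = (\<Sum>i\<in>B. (card N - 1) choose s)"
    using card_ksubsets_in[OF assms(1)] assms(2) by (intro sum.cong refl) auto
  finally show ?thesis by simp
qed

lemma avg_le:
  assumes "\<And>X. X \<subseteq> A \<Longrightarrow> card X = s \<Longrightarrow> g X \<le> h X"
  shows "avg g A s \<le> avg h A s"
  unfolding avg_def using assms by (intro divide_right_mono sum_mono) auto

lemma avg_sum: "avg (\<lambda>X. \<Sum>j\<in>J. g j X) A s = (\<Sum>j\<in>J. avg (g j) A s)"
  unfolding avg_def by (subst sum.swap) (simp add: sum_divide_distrib)

lemma avg_add: "avg (\<lambda>X. g X + h X) A s = avg g A s + avg h A s"
  unfolding avg_def by (simp add: sum.distrib add_divide_distrib)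

lemma avg_diff: "avg (\<lambda>X. g X - h X) A s = avg g A s - avg h A s"
  unfolding avg_def by (simp add: sum_subtractf diff_divide_distrib)

lemma avg_const: "finite A \<Longrightarrow> s \<le> card A \<Longrightarrow> avg (\<lambda>_. c) A s = c"
  unfolding avg_def by (simp add: n_subsets)

text \<open>The half-open intervals between consecutive values \<open>M / 2 ^ j\<close> tile the
  range from \<open>M / 2 ^ J\<close> to \<open>M\<close>; the induction splits off the lowest one.
  For \<open>M \<le> 0\<close> the assumptions contradict each other.\<close>

lemma dyadic_bin_exists:
  fixes x M :: real
  assumes "x \<le> M" "M / 2 ^ J < x"
  shows "\<exists>j\<in>{1..J}. M / 2 ^ j < x \<and> x \<le> M / 2 ^ (j - 1)"
  using assms(2)
proof (induction J)
  case (Suc J)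
  show ?case
  proof (cases "M / 2 ^ J < x")
    case True
    from Suc.IH[OF this] obtain j where "j \<in> {1..J}" "M / 2 ^ j < x \<and> x \<le> M / 2 ^ (j - 1)"
      by blast
    then show ?thesis by (intro bexI[of _ j]) auto
  next
    case False
    with Suc.prems show ?thesis by (intro bexI[of _ "Suc J"]) auto
  qed
qed (use assms(1) in simp)

subsection \<open>Monotone submodular functions\<close>

text \<open>\<open>f {}\<close> may be positive. Nonnegativity takes the place of the normalisation
  \<open>f {} = 0\<close>: it allows \<open>f C - f {}\<close> to be bounded by
  \<open>f C\<close>.\<close>

locale monotone_submodular =
  fixes N :: "nat set" and f :: "nat set \<Rightarrow> real"
  assumes finite_ground: "finite N"
    and monotone: "monotone_sf N f"
    and submodular: "submodular_sf N f"
    and nonneg: "S \<subseteq> N \<Longrightarrow> f S \<ge> 0"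
begin

lemma finite_sub: "S \<subseteq> N \<Longrightarrow> finite S"
  using finite_ground finite_subset by blast

lemma submodularD:
  assumes "A \<subseteq> B" "B \<subseteq> N" "e \<in> N"
  shows "f (insert e B) - f B \<le> f (insert e A) - f A"
  using submodular[unfolded submodular_sf_def, rule_format, OF assms] by simp

text \<open>Diminishing returns pass from single elements to sets by adding the elements of
  \<open>C\<close> one at a time and summing the gains.\<close>

lemma submodular_set:
  assumes "A \<subseteq> B" "B \<subseteq> N" "C \<subseteq> N"
  shows "f (B \<union> C) - f B \<le> f (A \<union> C) - f A"
proof -
  have "finite C"
    using assms by (simp add: finite_sub)
  then show ?thesis using assms
  proof (induction C rule: finite_induct)
    case (insert x F)
    have "f (insert x (B \<union> F)) - f (B \<union> F) \<le> f (insert x (A \<union> F)) - f (A \<union> F)"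
      using insert.prems by (intro submodularD) auto
    with insert show ?case by simp
  qed simp
qed

lemma f_mono:
  assumes "A \<subseteq> B" "B \<subseteq> N"
  shows "f A \<le> f B"
proof -
  have step: "f S \<le> f (insert e S)" if "S \<subseteq> N" "e \<in> N" for S e
    using monotone[unfolded monotone_sf_def, rule_format, OF that] by simp
  have "f A \<le> f (A \<union> F)" if "finite F" "F \<subseteq> N" for F
    using that
  proof (induction F rule: finite_induct)
    case (insert y G)
    then have "f A \<le> f (A \<union> G)" by simp
    also have "\<dots> \<le> f (insert y (A \<union> G))"
      using insert.prems assms by (intro step) auto
    finally show ?case by simp
  qed simp
  moreover have "finite B" "A \<union> B = B"
    using assms by (auto intro: finite_sub)
  ultimately show ?thesis
    using assms(2) by metis
qed

text \<open>The sets \<open>C j\<close> are added to \<open>R\<close> one after another; each gains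
  at most what it would gain over \<open>R\<close> alone.\<close>

lemma marginal_UN_le:
  assumes "finite J" "R \<subseteq> N" "\<And>j. j \<in> J \<Longrightarrow> C j \<subseteq> N"
  shows "f (R \<union> (\<Union>j\<in>J. C j)) - f R \<le> (\<Sum>j\<in>J. f (R \<union> C j) - f R)"
  using assms
proof (induction J rule: finite_induct)
  case (insert j J)
  let ?U = "\<Union>j\<in>J. C j"
  have "f (R \<union> ?U \<union> C j) - f (R \<union> ?U) \<le> f (R \<union> C j) - f R"
    using insert.prems by (intro submodular_set) auto
  moreover have "R \<union> ?U \<union> C j = R \<union> (\<Union>j\<in>insert j J. C j)"
    by auto
  moreover have "f (R \<union> ?U) - f R \<le> (\<Sum>j\<in>J. f (R \<union> C j) - f R)"
    using insert by simp
  ultimately show ?case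
    using insert.hyps by simp
qed simp

lemma marginal_le_sum:
  assumes "R \<subseteq> N" "C \<subseteq> N"
  shows "f (R \<union> C) - f R \<le> (\<Sum>i\<in>C. f (insert i R) - f R)"
proof -
  have "finite C"
    using assms by (simp add: finite_sub)
  then have "f (R \<union> (\<Union>i\<in>C. {i})) - f R \<le> (\<Sum>i\<in>C. f (R \<union> {i}) - f R)"
    using assms by (intro marginal_UN_le) auto
  then show ?thesis by simp
qed

lemma marginal_le:
  assumes "R \<subseteq> N" "C \<subseteq> N"
  shows "f (R \<union> C) - f R \<le> f C"
  using submodular_set[of "{}" R C] assms nonneg[of "{}"] by simp

text \<open>When \<open>Y\<close> is built up from the empty set, the step adding \<open>x\<close>
  gains at least the marginal of \<open>x\<close> over \<open>Z - {x}\<close>, which contains the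
  set built so far. The gains telescope to \<open>f Y - f {}\<close>.\<close>

lemma sum_marginals_le:
  assumes "Y \<subseteq> Z" "Z \<subseteq> N"
  shows "(\<Sum>i\<in>Y. f Z - f (Z - {i})) \<le> f Y"
proof -
  have "finite Y"
    using assms by (blast intro: finite_sub)
  then have "(\<Sum>i\<in>Y. f Z - f (Z - {i})) \<le> f Y - f {}" using assms
  proof (induction Y rule: finite_induct)
    case (insert x F)
    have "f (insert x (Z - {x})) - f (Z - {x}) \<le> f (insert x F) - f F"
      using insert by (intro submodularD) auto
    moreover have "insert x (Z - {x}) = Z"
      using insert.prems by auto
    ultimately show ?case
      using insert by simp
  qed simp
  with nonneg[of "{}"] show ?thesis by simp
qed

section \<open>Averages of a monotone submodular function over subsets of a fixed size\<close>

lemma avg_nonneg: "A \<subseteq> N \<Longrightarrow> avg f A s \<ge> 0"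
  unfolding avg_def by (intro divide_nonneg_nonneg sum_nonneg nonneg) auto

text \<open>Both parts compare \<open>f Y\<close> with the values \<open>f (Y - {i})\<close> over
  all pairs \<open>i \<in> Y\<close>. Monotonicity gives the first. For the second, the
  \<open>Suc s\<close> deletions from \<open>Y\<close> lose at most \<open>f Y\<close> altogether,
  so at least \<open>s * f Y\<close> remains.\<close>

lemma avg_Suc_bounds:
  assumes A: "A \<subseteq> N" and s: "Suc s \<le> card A"
  shows "avg f A s \<le> avg f A (Suc s)"
    and "real s * avg f A (Suc s) \<le> real (Suc s) * avg f A s"
proof -
  have finA: "finite A"
    using A by (rule finite_sub)
  \<comment> \<open>\<open>c\<close> is the number of these pairs, counted from
    \<open>Y - {i}\<close> here and from \<open>Y\<close> in \<open>c'\<close>.\<close>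
  define c where "c = real (card A - s) * real (card A choose s)"
  have c: "c > 0"
    using s by (simp add: c_def)
  have c': "c = real (Suc s) * real (card A choose Suc s)"
    unfolding c_def using binomial_absorb_comp[of "card A" s] binomial_absorption[of s "card A"]
    by (metis of_nat_mult)
  have lhs: "(\<Sum>Y\<in>ksubsets A (Suc s). \<Sum>i\<in>Y. f (Y - {i})) = c * avg f A s"
    unfolding sum_ksubsets_sum_remove[OF finA] c_def using finA s by (simp add: sum_ksubsets_eq_avg)
  have "(\<Sum>Y\<in>ksubsets A (Suc s). \<Sum>i\<in>Y. f (Y - {i})) \<le> (\<Sum>Y\<in>ksubsets A (Suc s). real (Suc s) * f Y)"
  proof (rule sum_mono)
    fix Y assume Y: "Y \<in> ksubsets A (Suc s)"
    then have "(\<Sum>i\<in>Y. f (Y - {i})) \<le> (\<Sum>i\<in>Y. f Y)"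
      using A by (intro sum_mono f_mono) auto
    with Y show "(\<Sum>i\<in>Y. f (Y - {i})) \<le> real (Suc s) * f Y" by simp
  qed
  also have "\<dots> = c * avg f A (Suc s)"
    using finA s unfolding c' by (simp only: sum_ksubsets_eq_avg flip: sum_distrib_left) simp
  finally show "avg f A s \<le> avg f A (Suc s)"
    using c unfolding lhs by simp
  have "real s * avg f A (Suc s) * c = real (Suc s) * (\<Sum>Y\<in>ksubsets A (Suc s). real s * f Y)"
    using finA s unfolding c' by (simp only: sum_ksubsets_eq_avg flip: sum_distrib_left) simp
  also have "\<dots> \<le> real (Suc s) * (\<Sum>Y\<in>ksubsets A (Suc s). \<Sum>i\<in>Y. f (Y - {i}))"
  proof (intro mult_left_mono sum_mono)
    fix Y assume Y: "Y \<in> ksubsets A (Suc s)"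
    have "(\<Sum>i\<in>Y. f Y - f (Y - {i})) \<le> f Y"
      using Y A by (intro sum_marginals_le) auto
    with Y show "real s * f Y \<le> (\<Sum>i\<in>Y. f (Y - {i}))"
      by (simp add: sum_subtractf algebra_simps)
  qed simp
  also have "\<dots> = real (Suc s) * avg f A s * c"
    unfolding lhs by simp
  finally show "real s * avg f A (Suc s) \<le> real (Suc s) * avg f A s"
    using c by simp
qed

lemma avg_mono:
  assumes "A \<subseteq> N" "s \<le> t" "t \<le> card A"
  shows "avg f A s \<le> avg f A t"
  using assms(2,3)
proof (induction t rule: dec_induct)
  case (step t)
  with avg_Suc_bounds(1)[OF assms(1), of t] show ?case by simp
qed simp

text \<open>\<open>avg f A s / s\<close> does not increase with \<open>s\<close>. With
  \<open>t = card A\<close> this says that a random \<open>s\<close>-subset keeps in the mean at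
  least the fraction \<open>s / card A\<close> of \<open>f A\<close>.\<close>

lemma avg_ratio:
  assumes "A \<subseteq> N" "s \<le> t" "t \<le> card A"
  shows "real s * avg f A t \<le> real t * avg f A s"
  using assms(2,3)
proof (induction t rule: dec_induct)
  case (step t)
  show ?case
  proof (cases "t = 0")
    case False
    have "real t * (real s * avg f A (Suc t)) \<le> real s * (real (Suc t) * avg f A t)"
      using mult_left_mono[OF avg_Suc_bounds(2)[OF assms(1) step.prems], of "real s"]
      by (simp add: mult_ac)
    also have "\<dots> \<le> real (Suc t) * (real t * avg f A s)"
      using mult_left_mono[OF step.IH, of "real (Suc t)"] step.prems
      by (simp add: mult_ac)
    also have "\<dots> = real t * (real (Suc t) * avg f A s)"
      by (simp only: mult_ac)
    finally show ?thesis
      using False by (simp add: mult_le_cancel_left_pos)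
  qed (use step avg_nonneg[OF assms(1)] in auto)
qed simp

lemma avg_card: "A \<subseteq> N \<Longrightarrow> avg f A (card A) = f A"
proof -
  assume A: "A \<subseteq> N"
  have "finite A"
    using A by (rule finite_sub)
  then have "ksubsets A (card A) = {A}"
    using card_subset_eq by blast
  then show ?thesis by (simp add: avg_def)
qed

text \<open>The quantity estimated by \<open>v_hat r xs i\<close>.\<close>

definition marginal :: "nat \<Rightarrow> nat \<Rightarrow> real" where
  "marginal r i = (\<Sum>X\<in>{X \<in> ksubsets N r. i \<notin> X}. f (insert i X) - f X) / real ((card N - 1) choose r)"

lemma sum_marginals_ksubsets:
  assumes "i \<in> N" "r < card N"
  shows "(\<Sum>Y\<in>{Y \<in> ksubsets N (Suc r). i \<in> Y}. f Y - f (Y - {i})) = marginal r i * real ((card N - 1) choose r)"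
proof -
  have "(\<Sum>Y\<in>{Y \<in> ksubsets N (Suc r). i \<in> Y}. f Y - f (Y - {i}))
      = (\<Sum>Y\<in>{Y \<in> ksubsets N (Suc r). i \<in> Y}. f (insert i (Y - {i})) - f (Y - {i}))"
    by (intro sum.cong refl) (auto simp: insert_absorb)
  also have "\<dots> = (\<Sum>X\<in>{X \<in> ksubsets N r. i \<notin> X}. f (insert i X) - f X)"
    by (rule sum_ksubsets_remove[OF finite_ground assms(1)])
  finally show ?thesis
    using assms by (simp add: marginal_def)
qed

text \<open>Removing \<open>i\<close> from a uniform \<open>Suc r\<close>-set containing
  \<open>i\<close> leaves a uniform \<open>r\<close>-set avoiding \<open>i\<close>. So the two
  means, which \<open>v_hat\<close> estimates from different samples, differ exactly by the mean
  marginal.\<close>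

lemma marginal_eq_diff:
  assumes "i \<in> N"
  shows "marginal r i =
    (\<Sum>Y\<in>{Y \<in> ksubsets N (Suc r). i \<in> Y}. f Y) / real (card {Y \<in> ksubsets N (Suc r). i \<in> Y})
    - (\<Sum>X\<in>{X \<in> ksubsets N r. i \<notin> X}. f X) / real (card {X \<in> ksubsets N r. i \<notin> X})"
proof -
  have "(\<Sum>Y\<in>{Y \<in> ksubsets N (Suc r). i \<in> Y}. f Y) = (\<Sum>Y\<in>{Y \<in> ksubsets N (Suc r). i \<in> Y}. f (insert i (Y - {i})))"
    by (intro sum.cong refl) (auto simp: insert_absorb)
  also have "\<dots> = (\<Sum>X\<in>{X \<in> ksubsets N r. i \<notin> X}. f (insert i X))"
    by (rule sum_ksubsets_remove[OF finite_ground assms])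
  finally show ?thesis
    unfolding card_ksubsets_in[OF finite_ground assms] card_ksubsets_notin[OF finite_ground assms] marginal_def
    by (simp add: sum_subtractf diff_divide_distrib)
qed

lemma marginal_nonneg:
  assumes "i \<in> N"
  shows "marginal r i \<ge> 0"
proof -
  have "f X \<le> f (insert i X)" if "X \<subseteq> N" for X
    using that assms by (intro f_mono) auto
  then show ?thesis
    unfolding marginal_def by (intro divide_nonneg_nonneg sum_nonneg) simp_all
qed

lemma marginal_le_singleton:
  assumes "i \<in> N" "r < card N"
  shows "marginal r i \<le> f {i}"
proof -
  have "(\<Sum>X\<in>{X \<in> ksubsets N r. i \<notin> X}. f (insert i X) - f X) \<le> (\<Sum>X\<in>{X \<in> ksubsets N r. i \<notin> X}. f {i})"
  proof (rule sum_mono)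
    fix X assume "X \<in> {X \<in> ksubsets N r. i \<notin> X}"
    then show "f (insert i X) - f X \<le> f {i}"
      using marginal_le[of X "{i}"] assms by simp
  qed
  also have "\<dots> = f {i} * real ((card N - 1) choose r)"
    using card_ksubsets_notin[OF finite_ground assms(1), of r] by simp
  finally show ?thesis
    using assms by (simp add: marginal_def divide_le_eq)
qed

text \<open>Sets \<open>R\<close> that already contain \<open>i\<close> contribute 0, so averaging
  over all \<open>r\<close>-sets instead of those avoiding \<open>i\<close> can only lower the
  mean.\<close>

lemma avg_marginal_le:
  assumes "i \<in> N" "r < card N"
  shows "avg (\<lambda>R. f (insert i R) - f R) N r \<le> marginal r i"
proof -
  have "(\<Sum>R\<in>ksubsets N r. f (insert i R) - f R) = (\<Sum>X\<in>{X \<in> ksubsets N r. i \<notin> X}. f (insert i X) - f X)"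
    using finite_ksubsets[OF finite_ground] by (intro sum.mono_neutral_right) (auto simp: insert_absorb)
  also have "\<dots> = marginal r i * real ((card N - 1) choose r)"
    using assms by (simp add: marginal_def)
  also have "\<dots> \<le> marginal r i * real (card N choose r)"
    using marginal_nonneg[OF assms(1)] by (intro mult_left_mono) (simp_all add: binomial_right_mono)
  finally show ?thesis
    using assms by (simp add: avg_def divide_le_eq)
qed

text \<open>A uniformly random \<open>(r+1)\<close>-set meets \<open>B\<close> in about \<open>card B * (r+1) / card N\<close> elements, each of which
  contributes at least \<open>v\<close> to the value of the intersection; by symmetry the intersection is a
  uniformly random subset of \<open>B\<close> of its size.\<close>

lemma avg_ge_of_marginals:
  assumes B: "B \<subseteq> N" and r: "r < card N" and t: "1 \<le> t" "t \<le> card B"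
    and v: "\<And>i. i \<in> B \<Longrightarrow> v \<le> marginal r i"
  shows "real (card B) * v \<le> avg f B t * (real (card N) / real (Suc r) + real (card B) / real t)"
proof -
  have finB: "finite B"
    using B by (rule finite_sub)
  define c where "c = real ((card N - 1) choose r)"
  have c: "c > 0"
    using r by (simp add: c_def)
  have cN: "real (card N choose Suc r) = real (card N) / real (Suc r) * c"
    unfolding c_def using binomial_absorption[of r "card N"] r
    by (simp add: field_simps flip: of_nat_mult of_nat_Suc)
  \<comment> \<open>Monotonicity covers \<open>h \<le> t\<close> and \<open>avg_ratio\<close> covers
    \<open>h > t\<close>. The common bound is affine in \<open>h\<close>, so that only the mean size
    of \<open>Y \<inter> B\<close> enters below.\<close>
  have le: "avg f B h \<le> (1 + real h / real t) * avg f B t" if "h \<le> card B" for h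
  proof (cases "h \<le> t")
    case True
    then have "avg f B h \<le> avg f B t"
      using B t by (intro avg_mono) auto
    also have "\<dots> \<le> (1 + real h / real t) * avg f B t"
      using avg_nonneg[OF B, of t] by (simp add: distrib_right)
    finally show ?thesis .
  next
    case False
    then have "real t * avg f B h \<le> real h * avg f B t"
      using that B t by (intro avg_ratio) auto
    then have "avg f B h \<le> real h / real t * avg f B t"
      using t by (simp add: field_simps)
    then show ?thesis
      using avg_nonneg[OF B, of t] by (simp add: distrib_right)
  qed
  have "real (card B) * v * c = (\<Sum>i\<in>B. v * c)"
    by simp
  also have "\<dots> \<le> (\<Sum>i\<in>B. marginal r i * c)"
    using v c by (intro sum_mono mult_right_mono) auto
  also have "\<dots> = (\<Sum>i\<in>B. \<Sum>Y\<in>{Y \<in> ksubsets N (Suc r). i \<in> Y}. f Y - f (Y - {i}))"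
    using B r unfolding c_def by (intro sum.cong refl sum_marginals_ksubsets[symmetric]) auto
  also have "\<dots> = (\<Sum>Y\<in>ksubsets N (Suc r). \<Sum>i\<in>{i \<in> B. i \<in> Y}. f Y - f (Y - {i}))"
    by (rule sum.swap_restrict[OF finB finite_ksubsets[OF finite_ground]])
  also have "\<dots> = (\<Sum>Y\<in>ksubsets N (Suc r). \<Sum>i\<in>Y \<inter> B. f Y - f (Y - {i}))"
    by (intro sum.cong refl) auto
  also have "\<dots> \<le> (\<Sum>Y\<in>ksubsets N (Suc r). f (Y \<inter> B))"
    by (intro sum_mono sum_marginals_le) auto
  also have "\<dots> \<le> (\<Sum>Y\<in>ksubsets N (Suc r). (1 + real (card (Y \<inter> B)) / real t) * avg f B t)"
  proof (rule sum_ksubsets_trace_le[OF finite_ground B])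
    fix h assume h: "h \<le> card B"
    have "(\<Sum>X\<in>ksubsets B h. f X) = avg f B h * real (card B choose h)"
      using h finB by (simp add: sum_ksubsets_eq_avg)
    also have "\<dots> \<le> (1 + real h / real t) * avg f B t * real (card B choose h)"
      using le[OF h] by (intro mult_right_mono) auto
    also have "\<dots> = (\<Sum>X\<in>ksubsets B h. (1 + real (card X) / real t) * avg f B t)"
      using finB by (simp add: n_subsets)
    finally show "(\<Sum>X\<in>ksubsets B h. f X) \<le> (\<Sum>X\<in>ksubsets B h. (1 + real (card X) / real t) * avg f B t)" .
  qed
  also have "\<dots> = (real (card N choose Suc r) + real (\<Sum>Y\<in>ksubsets N (Suc r). card (Y \<inter> B)) / real t) * avg f B t"
    by (simp add: sum.distrib n_subsets finite_ground flip: sum_distrib_right sum_divide_distrib)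
  also have "\<dots> = avg f B t * (real (card N) / real (Suc r) + real (card B) / real t) * c"
    unfolding sum_card_inter_ksubsets[OF finite_ground B] cN
    by (simp add: c_def algebra_simps)
  finally show ?thesis
    using c by simp
qed

text \<open>Against a typical \<open>R\<close> the optimum still has marginal value \<open>V/2\<close>; by submodularity one of the \<open>J\<close>
  bins carries a \<open>1/(4J)\<close> fraction of \<open>V\<close>, since the elements below all bins are negligible.\<close>

lemma heavy_bin_exists:
  fixes u :: "nat \<Rightarrow> real" and V :: real
  assumes n: "card N = n" "12 \<le> n" and r: "r < n"
    and opt: "T \<subseteq> N" "f T = V" "0 < V" and single: "\<And>i. i \<in> N \<Longrightarrow> f {i} \<le> V"
    and small: "avg f N r \<le> V / 2"
    and est: "\<And>i. i \<in> N \<Longrightarrow> \<bar>u i - marginal r i\<bar> \<le> V / real n ^ 2"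
    and J: "1 \<le> J" "real n ^ 3 \<le> 2 ^ J"
    and vm: "vm = Max (u ` N)"
  shows "\<exists>j\<in>{1..J}. V / (4 * real J) \<le>
    avg (\<lambda>R. f (R \<union> (T \<inter> {i \<in> N. vm / 2 ^ j < u i \<and> u i \<le> vm / 2 ^ (j - 1)})) - f R) N r"
proof (rule ccontr)
  \<comment> \<open>\<open>C j\<close> is the part of the optimum in bin \<open>j\<close>, and
    \<open>L\<close> is its part below all bins.\<close>
  define C where "C j = T \<inter> {i \<in> N. vm / 2 ^ j < u i \<and> u i \<le> vm / 2 ^ (j - 1)}" for j
  define L where "L = T \<inter> {i \<in> N. u i \<le> vm / 2 ^ J}"
  assume "\<not> ?thesis"
  then have small_bins: "avg (\<lambda>R. f (R \<union> C j) - f R) N r < V / (4 * real J)" if "j \<in> {1..J}" for j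
    using that unfolding C_def by (meson not_le)
  have finN: "finite N" "N \<noteq> {}"
    using finite_ground n by auto
  have n0: "real n \<ge> 12"
    using n by simp
  have u_le_vm: "u i \<le> vm" if "i \<in> N" for i
    using that finN by (simp add: vm)
  have T_eq: "T = (\<Union>j\<in>{1..J}. C j) \<union> L"
  proof
    show "T \<subseteq> (\<Union>j\<in>{1..J}. C j) \<union> L"
    proof
      fix i assume i: "i \<in> T"
      with opt have iN: "i \<in> N" by auto
      show "i \<in> (\<Union>j\<in>{1..J}. C j) \<union> L"
      proof (cases "vm / 2 ^ J < u i")
        case True
        from dyadic_bin_exists[OF u_le_vm[OF iN] True] show ?thesis
          using i iN by (auto simp: C_def)
      qed (use i iN in \<open>auto simp: L_def\<close>)
    qed
  qed (auto simp: C_def L_def)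
  have vm_le: "vm \<le> 2 * V"
  proof -
    have "vm \<in> u ` N"
      unfolding vm using finN by (intro Max_in) auto
    then obtain i where i: "i \<in> N" "vm = u i"
      by blast
    have "V / real n ^ 2 \<le> V / 1"
      using n0 opt(3) by (intro divide_left_mono) auto
    then show ?thesis
      using est[OF i(1)] marginal_le_singleton[of i r] single[OF i(1)] i n r by auto
  qed
  \<comment> \<open>The largest estimate is at most \<open>2 * V\<close>, and the \<open>J\<close>
    bins reach down by a factor of at least \<open>n ^ 3\<close>.\<close>
  have "vm / 2 ^ J \<le> 2 * V / 2 ^ J"
    using vm_le by (intro divide_right_mono) auto
  also have "\<dots> \<le> 2 * V / real n ^ 3"
    using J(2) opt(3) n0 by (intro divide_left_mono) auto
  also have "\<dots> \<le> V / real n ^ 2"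
    using n0 opt(3) by (simp add: field_simps power2_eq_square power3_eq_cube)
  finally have threshold: "vm / 2 ^ J \<le> V / real n ^ 2" .
  \<comment> \<open>The left side is at least \<open>V / 2\<close>. On the right the bins contribute
    less than \<open>V / 4\<close>, and the at most \<open>n\<close> elements of \<open>L\<close>
    contribute at most \<open>2 * V / n \<le> V / 4\<close>, a contradiction.\<close>
  have "V - avg f N r = avg (\<lambda>R. V - f R) N r"
    using n r finN by (simp add: avg_diff avg_const)
  also have "\<dots> \<le> avg (\<lambda>R. (\<Sum>j\<in>{1..J}. f (R \<union> C j) - f R) + (\<Sum>i\<in>L. f (insert i R) - f R)) N r"
  proof (rule avg_le)
    fix R assume R: "R \<subseteq> N"
    let ?U = "\<Union>j\<in>{1..J}. C j"
    have U: "?U \<subseteq> N" "L \<subseteq> N"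
      using opt by (auto simp: C_def L_def)
    have "V \<le> f (R \<union> T)"
      using opt R f_mono[of T "R \<union> T"] by auto
    also have "R \<union> T = (R \<union> ?U) \<union> L"
      using T_eq by auto
    also have "f \<dots> - f (R \<union> ?U) \<le> f (R \<union> L) - f R"
      using U R by (intro submodular_set) auto
    finally have "V - f R \<le> (f (R \<union> ?U) - f R) + (f (R \<union> L) - f R)"
      by simp
    moreover have "f (R \<union> ?U) - f R \<le> (\<Sum>j\<in>{1..J}. f (R \<union> C j) - f R)"
      using R by (intro marginal_UN_le) (auto simp: C_def)
    moreover have "f (R \<union> L) - f R \<le> (\<Sum>i\<in>L. f (insert i R) - f R)"
      using R U by (intro marginal_le_sum)
    ultimately show "V - f R \<le> (\<Sum>j\<in>{1..J}. f (R \<union> C j) - f R) + (\<Sum>i\<in>L. f (insert i R) - f R)"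
      by linarith
  qed
  also have "\<dots> = (\<Sum>j\<in>{1..J}. avg (\<lambda>R. f (R \<union> C j) - f R) N r)
      + (\<Sum>i\<in>L. avg (\<lambda>R. f (insert i R) - f R) N r)"
    by (simp only: avg_add avg_sum)
  also have "\<dots> < (\<Sum>j\<in>{1..J}. V / (4 * real J)) + (\<Sum>i\<in>L. 2 * V / real n ^ 2)"
  proof (rule add_less_le_mono)
    show "(\<Sum>j\<in>{1..J}. avg (\<lambda>R. f (R \<union> C j) - f R) N r) < (\<Sum>j\<in>{1..J}. V / (4 * real J))"
      using small_bins J(1) by (intro sum_strict_mono) auto
    show "(\<Sum>i\<in>L. avg (\<lambda>R. f (insert i R) - f R) N r) \<le> (\<Sum>i\<in>L. 2 * V / real n ^ 2)"
    proof (rule sum_mono)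
      fix i assume "i \<in> L"
      then have i: "i \<in> N" "u i \<le> vm / 2 ^ J"
        by (auto simp: L_def)
      have "avg (\<lambda>R. f (insert i R) - f R) N r \<le> marginal r i"
        using i n r by (intro avg_marginal_le) auto
      then show "avg (\<lambda>R. f (insert i R) - f R) N r \<le> 2 * V / real n ^ 2"
        using est[OF i(1)] i(2) threshold by (simp add: abs_le_iff)
    qed
  qed
  also have "(\<Sum>j\<in>{1..J}. V / (4 * real J)) = V / 4"
    using J(1) by simp
  also have "(\<Sum>i\<in>L. 2 * V / real n ^ 2) \<le> 2 * V / real n"
  proof -
    have "card L \<le> n"
      using card_mono[OF finite_ground, of L] n by (auto simp: L_def)
    then have "(\<Sum>i\<in>L. 2 * V / real n ^ 2) \<le> real n * (2 * V / real n ^ 2)"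
      using opt(3) by (simp add: mult_right_mono del: times_divide_eq_right)
    then show ?thesis
      using n0 by (simp add: power2_eq_square)
  qed
  also have "2 * V / real n \<le> V / 4"
    using n0 opt(3) by (simp add: field_simps)
  finally show False
    using small by simp
qed

text \<open>The heavy bin is good whatever its size. With at most \<open>k\<close> elements it is
  returned whole; otherwise \<open>FV1\<close>, strong for small bins, and \<open>FV2\<close>,
  strong for large ones, bound the mean value of a random \<open>k\<close>-subset from
  below.\<close>

lemma good_bin_exists:
  fixes u :: "nat \<Rightarrow> real" and V :: real
  assumes n: "card N = n" "12 \<le> n" "n = r ^ 2" and k: "1 \<le> k" "k \<le> n"
    and opt: "T \<subseteq> N" "card T \<le> k" "f T = V" "0 < V" and single: "\<And>i. i \<in> N \<Longrightarrow> f {i} \<le> V"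
    and small: "avg f N r \<le> V / 2"
    and est: "\<And>i. i \<in> N \<Longrightarrow> \<bar>u i - marginal r i\<bar> \<le> V / real n ^ 2"
    and J: "1 \<le> J" "real n ^ 3 \<le> 2 ^ J" "32 * J \<le> n"
    and vm: "vm = Max (u ` N)"
    and B: "\<And>j. B j = {i \<in> N. vm / 2 ^ j < u i \<and> u i \<le> vm / 2 ^ (j - 1)}"
  shows "\<exists>j\<in>{1..J}. V / (64 * real J * sqrt (real r)) \<le> avg f (B j) (min (card (B j)) k)"
proof -
  have r: "r < n" "1 \<le> r"
  proof -
    have "r \<noteq> 0" "r \<noteq> 1"
      by (rule notI, use n in simp)+
    then show "1 \<le> r" "r < n"
      using n(3) by (auto simp: power2_eq_square)
  qed
  obtain j where j: "j \<in> {1..J}" and heavy: "V / (4 * real J) \<le> avg (\<lambda>R. f (R \<union> (T \<inter> B j)) - f R) N r"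
    using heavy_bin_exists[OF n(1,2) r(1) opt(1,3,4) single small est J(1,2) vm] unfolding B by blast
  define w where "w = vm / 2 ^ j"
  define b where "b = card (B j)"
  define F where "F = avg f (B j) (min b k)"
  have BN: "B j \<subseteq> N"
    by (auto simp: B)
  have in_bin: "w < u i \<and> u i \<le> 2 * w" if "i \<in> B j" for i
  proof -
    have "(2::real) ^ j = 2 * 2 ^ (j - 1)"
      using j by (simp flip: power_Suc)
    then show ?thesis
      using that by (simp add: B w_def)
  qed
  have F0: "F \<ge> 0"
    unfolding F_def using BN by (rule avg_nonneg)
  have J0: "real J > 0"
    using J by simp
  have value_bin: "V / (4 * real J) \<le> f (B j)"
  proof -
    have "avg (\<lambda>R. f (R \<union> (T \<inter> B j)) - f R) N r \<le> avg (\<lambda>_. f (B j)) N r"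
    proof (rule avg_le)
      fix R assume "R \<subseteq> N"
      then have "f (R \<union> (T \<inter> B j)) - f R \<le> f (T \<inter> B j)"
        using BN by (intro marginal_le) auto
      also have "\<dots> \<le> f (B j)"
        using BN by (intro f_mono) auto
      finally show "f (R \<union> (T \<inter> B j)) - f R \<le> f (B j)" .
    qed
    also have "\<dots> = f (B j)"
      using n r finite_ground by (simp add: avg_const)
    finally show ?thesis
      using heavy by simp
  qed
  \<comment> \<open>The estimation errors of \<open>k\<close> elements add up to at most one unit
    \<open>V / (32 * J)\<close>; this is where \<open>32 * J \<le> n\<close> enters.\<close>
  have eps: "real k * (V / real n ^ 2) \<le> V / (32 * real J)"
  proof -
    have "real k * (V / real n ^ 2) \<le> real n * (V / real n ^ 2)"
      using k opt(4) by (intro mult_right_mono) auto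
    also have "\<dots> = V / real n"
      by (simp add: power2_eq_square)
    also have "\<dots> \<le> V / real (32 * J)"
      using J(1,3) opt(4) n(2) by (intro divide_left_mono) (simp_all only: of_nat_le_iff, auto)
    finally show ?thesis by simp
  qed
  have weight: "V / (4 * real J) \<le> real k * (2 * w + V / real n ^ 2)"
  proof -
    have "avg (\<lambda>R. f (R \<union> (T \<inter> B j)) - f R) N r \<le> avg (\<lambda>R. \<Sum>i\<in>T \<inter> B j. f (insert i R) - f R) N r"
      using BN by (intro avg_le marginal_le_sum) auto
    also have "\<dots> = (\<Sum>i\<in>T \<inter> B j. avg (\<lambda>R. f (insert i R) - f R) N r)"
      by (rule avg_sum)
    also have "\<dots> \<le> (\<Sum>i\<in>T \<inter> B j. marginal r i)"
      using BN n r by (intro sum_mono avg_marginal_le) auto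
    finally have le: "V / (4 * real J) \<le> (\<Sum>i\<in>T \<inter> B j. marginal r i)"
      using heavy by simp
    have each: "marginal r i \<le> 2 * w + V / real n ^ 2" if "i \<in> T \<inter> B j" for i
      using that in_bin[of i] est[of i] BN by (auto simp: abs_le_iff)
    \<comment> \<open>An element of \<open>T \<inter> B j\<close> shows that the bound in
      \<open>each\<close> is nonnegative, so the number of summands may be replaced by
      \<open>k\<close>.\<close>
    have "T \<inter> B j \<noteq> {}"
      using le opt(4) J0 by (auto simp: zero_less_divide_iff dest: leD)
    then have pos: "2 * w + V / real n ^ 2 \<ge> 0"
      using each marginal_nonneg[of _ r] BN by (meson IntD2 ex_in_conv order_trans subsetD)
    have "card (T \<inter> B j) \<le> k"
      using card_mono[of T "T \<inter> B j"] finite_sub[OF opt(1)] opt(2) by auto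
    then have "(\<Sum>i\<in>T \<inter> B j. marginal r i) \<le> real k * (2 * w + V / real n ^ 2)"
      using sum_bounded_above[of "T \<inter> B j" "marginal r", OF each] pos
      by (meson mult_right_mono of_nat_le_iff order_trans)
    with le show ?thesis by simp
  qed
  \<comment> \<open>In units of \<open>V / (32 * J)\<close>, the left side of \<open>weight\<close>
    is 8 and the error is at most 1. So \<open>k * w\<close> is at least 3.5 and stays above 1 after
    subtracting the error.\<close>
  have v: "V / (32 * real J) \<le> real k * (w - V / real n ^ 2)"
  proof -
    have "V / (4 * real J) = 8 * (V / (32 * real J))"
      by simp
    then show ?thesis
      using weight eps opt(4) J0 unfolding distrib_left right_diff_distrib by (simp add: field_simps)
  qed
  define s where "s = sqrt (real r)"
  have s: "s \<ge> 1" "real r = s * s"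
    using r by (auto simp: s_def)
  have "V \<le> 64 * real J * s * F"
  proof (cases "b \<le> k")
    case True
    then have "F = f (B j)"
      unfolding F_def b_def using avg_card[OF BN] by (simp add: min_def)
    then have "V \<le> 4 * real J * F * 1"
      using value_bin J0 by (simp add: field_simps)
    also have "\<dots> \<le> 4 * real J * F * s"
      using s J0 F0 by (intro mult_left_mono) auto
    also have "\<dots> \<le> 64 * real J * s * F"
      using s J0 F0 by simp
    finally show ?thesis .
  next
    case False
    then have kb: "k < b" "min b k = k"
      by auto
    have FV1: "real k * V \<le> 4 * real J * real b * F"
    proof -
      have "real k * f (B j) \<le> real b * F"
        using avg_ratio[OF BN, of k b] avg_card[OF BN] kb unfolding F_def b_def by simp
      moreover have "real k * (V / (4 * real J)) \<le> real k * f (B j)"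
        using value_bin by (intro mult_left_mono) auto
      ultimately have "real k * (V / (4 * real J)) \<le> real b * F"
        by linarith
      then show ?thesis
        using J0 by (simp add: field_simps)
    qed
    \<comment> \<open>This is \<open>avg_ge_of_marginals\<close> with \<open>t = k\<close>,
      multiplied by \<open>k\<close> and combined with \<open>v\<close>; \<open>n / Suc r\<close> is
      at most \<open>r\<close> because \<open>n = r ^ 2\<close>.\<close>
    have FV2: "real b * V \<le> 32 * real J * F * (real r * real k + real b)"
    proof -
      have "w - V / real n ^ 2 \<le> marginal r i" if "i \<in> B j" for i
        using in_bin[OF that] est[of i] that BN by (auto simp: abs_le_iff)
      then have "real b * (w - V / real n ^ 2) \<le> F * (real n / real (Suc r) + real b / real k)"
        using avg_ge_of_marginals[OF BN, of r k "w - V / real n ^ 2"] n(1) r k kb by (simp add: F_def b_def)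
      also have "real n / real (Suc r) \<le> real r"
        using n(3) by (simp add: divide_le_eq power2_eq_square algebra_simps)
      finally have "real k * (real b * (w - V / real n ^ 2)) \<le> real k * (F * (real r + real b / real k))"
        using F0 by (simp add: mult_left_mono)
      also have "\<dots> = F * (real r * real k + real b)"
        using k by (simp add: field_simps)
      finally have "real b * (V / (32 * real J)) \<le> F * (real r * real k + real b)"
        using mult_left_mono[OF v, of "real b"] by (simp add: mult_ac)
      then show ?thesis
        using J0 by (simp add: field_simps)
    qed
    \<comment> \<open>The two bounds balance at \<open>b = k * s\<close>. Up to there
      \<open>b / k\<close> in \<open>FV1\<close> is at most \<open>s\<close>; beyond it
      \<open>r * k = s * s * k\<close> in \<open>FV2\<close> is at most
      \<open>s * b\<close>.\<close>
    show ?thesis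
    proof (cases "real b \<le> real k * s")
      case True
      have "real k * V \<le> 4 * real J * F * real b"
        using FV1 by (simp add: mult_ac)
      also have "\<dots> \<le> 4 * real J * F * (real k * s)"
        using True J0 F0 by (intro mult_left_mono) auto
      also have "\<dots> \<le> real k * (64 * real J * s * F)"
        using J0 F0 s by (simp add: mult_ac)
      finally show ?thesis
        using k by simp
    next
      case False
      then have "real r * real k \<le> s * real b"
        using s by (simp add: mult_ac mult_left_mono)
      moreover have "1 * real b \<le> s * real b"
        using s by (intro mult_right_mono) auto
      ultimately have "32 * real J * F * (real r * real k + real b) \<le> 32 * real J * F * (2 * (s * real b))"
        using J0 F0 by (intro mult_left_mono) auto
      with FV2 have "real b * V \<le> real b * (64 * real J * s * F)"
        by (simp add: mult_ac)
      then show ?thesis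
        using kb by simp
    qed
  qed
  then have "V / (64 * real J * s) \<le> F"
    using J0 s by (simp add: divide_le_eq mult_ac)
  then show ?thesis
    using j unfolding F_def b_def s_def by blast
qed

text \<open>\<open>f T - f {}\<close> is at most \<open>k * (M - f {})\<close>, and for
  \<open>k \<ge> 1\<close> the surplus \<open>(k - 1) * f {}\<close> may be dropped. With
  \<open>k = n\<close> this later bounds \<open>f\<close> on all sets.\<close>

lemma value_le_card_mult:
  assumes "T \<subseteq> N" "card T \<le> k" "1 \<le> k" "N \<noteq> {}" and M: "\<And>i. i \<in> N \<Longrightarrow> f {i} \<le> M"
  shows "f T \<le> real k * M"
proof -
  have "f {} \<le> M"
  proof -
    from assms(4) obtain i where i: "i \<in> N" by blast
    have "f {} \<le> f {i}"
      using i by (intro f_mono) auto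
    with M[OF i] show ?thesis by simp
  qed
  have "f T - f {} \<le> (\<Sum>i\<in>T. f {i} - f {})"
    using marginal_le_sum[of "{}" T] assms(1) by simp
  also have "\<dots> \<le> (\<Sum>i\<in>T. M - f {})"
    using assms(1) M by (intro sum_mono) auto
  also have "\<dots> = real (card T) * (M - f {})"
    by simp
  also have "\<dots> \<le> real k * (M - f {})"
    using \<open>f {} \<le> M\<close> assms(2) by (intro mult_right_mono) auto
  finally have "f T \<le> real k * M - (real k - 1) * f {}"
    by (simp add: algebra_simps)
  moreover have "(real k - 1) * f {} \<ge> 0"
    using assms(3) nonneg[of "{}"] by simp
  ultimately show ?thesis by linarith
qed

text \<open>When a random \<open>r\<close>-set already has value \<open>V/2\<close>, either a random \<open>k\<close>-set is good or \<open>k\<close> is so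
  small that covering the best single element suffices.\<close>

lemma avg_k_or_singleton:
  fixes V :: real
  assumes n: "card N = n" "n = r ^ 2" and k: "1 \<le> k" "k \<le> n" and r: "1 \<le> r"
    and opt: "T \<subseteq> N" "card T \<le> k" "f T = V"
    and large: "V / 2 \<le> avg f N r"
  shows "(\<exists>i\<in>N. V / sqrt (real r) \<le> f {i}) \<or> V / (2 * sqrt (real r)) \<le> avg f N k"
proof (cases "real k \<le> sqrt (real r)")
  case True
  have V: "V \<ge> 0"
    using nonneg[OF opt(1)] opt(3) by simp
  have s0: "sqrt (real r) \<ge> 1"
    using r by simp
  have finN: "finite N" "N \<noteq> {}"
    using finite_ground n k by auto
  define M where "M = Max ((\<lambda>i. f {i}) ` N)"
  have M: "f {i} \<le> M" if "i \<in> N" for i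
    using that finN by (simp add: M_def)
  have "M \<in> (\<lambda>i. f {i}) ` N"
    unfolding M_def using finN by (intro Max_in) auto
  then obtain i where i: "i \<in> N" "M = f {i}"
    by blast
  have "V \<le> real k * M"
    using value_le_card_mult[OF opt(1,2) k(1) finN(2) M] opt(3) by simp
  also have "\<dots> \<le> sqrt (real r) * M"
    using True nonneg[of "{i}"] i by (intro mult_right_mono) auto
  finally have "V / sqrt (real r) \<le> f {i}"
    using s0 i(2) by (simp add: divide_le_eq mult_ac)
  with i(1) show ?thesis by blast
next
  case False
  have V: "V \<ge> 0"
    using nonneg[OF opt(1)] opt(3) by simp
  define s where "s = sqrt (real r)"
  have s: "s \<ge> 1" "real r = s * s" "s \<le> real k"
    using r False by (auto simp: s_def)
  have "V / (2 * s) \<le> avg f N k"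
  \<comment> \<open>For \<open>k < r\<close> a \<open>k\<close>-set keeps the fraction
    \<open>k / r \<ge> 1 / s\<close> of the mean, because \<open>r = s * s\<close> and
    \<open>s \<le> k\<close>.\<close>
  proof (cases "r \<le> k")
    case True
    then have "V / 2 \<le> avg f N k"
      using large avg_mono[of N r k] n k by simp
    moreover have "V / (2 * s) \<le> V / 2"
      using s V by (intro divide_left_mono) auto
    ultimately show ?thesis by linarith
  next
    case False
    have "r \<le> n"
      using n(2) r by (simp add: power2_eq_square)
    then have "real k * avg f N r \<le> real r * avg f N k"
      using False n by (intro avg_ratio) auto
    moreover have "s * (V / 2) \<le> real k * avg f N r"
      using s V large by (intro mult_mono) auto
    ultimately have "s * (V / 2) \<le> s * (s * avg f N k)"
      using s(2) by (simp add: mult_ac)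
    then have "V / 2 \<le> s * avg f N k"
      using s(1) by simp
    then show ?thesis
      using s(1) by (simp add: field_simps)
  qed
  then show ?thesis
    by (simp add: s_def)
qed

end

subsection \<open>Concentration of the samples\<close>

text \<open>Hoeffding's inequality for independent coordinates. The deviation is measured in units
  of the range \<open>M\<close>, which therefore cancels from the exponent.\<close>

lemma Pi_pmf_mean_concentration:
  fixes \<phi> :: "'a \<Rightarrow> real"
  assumes bnd: "\<And>S. S \<in> set_pmf D \<Longrightarrow> 0 \<le> \<phi> S \<and> \<phi> S \<le> M"
    and pos: "0 < M" "0 < m" "0 \<le> \<tau>"
  shows "measure_pmf.prob (Pi_pmf {..<m} dflt (\<lambda>_. D))
     {\<omega>. \<tau> * M * real m \<le> \<bar>(\<Sum>i<m. \<phi> (\<omega> i)) - real m * measure_pmf.expectation D \<phi>\<bar>}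
     \<le> 2 * exp (- 2 * real m * \<tau> ^ 2)"
proof -
  let ?P = "Pi_pmf {..<m} dflt (\<lambda>_. D)"
  have comp: "map_pmf (\<lambda>\<omega>. \<omega> i) ?P = D" if "i < m" for i
    using that by (subst Pi_pmf_component) auto
  have exp_comp: "measure_pmf.expectation ?P (\<lambda>\<omega>. \<phi> (\<omega> i)) = measure_pmf.expectation D \<phi>" if "i < m" for i
    by (subst comp[OF that, symmetric]) simp
  interpret Hoeffding_ineq "measure_pmf ?P" "{..<m}" "\<lambda>i \<omega>. \<phi> (\<omega> i)" "\<lambda>_. 0" "\<lambda>_. M"
    "real m * measure_pmf.expectation D \<phi>"
  proof unfold_locales
    show "prob_space.indep_vars (measure_pmf ?P) (\<lambda>_. borel) (\<lambda>i \<omega>. \<phi> (\<omega> i)) {..<m}"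
      by (rule prob_space.indep_vars_compose2[OF measure_pmf.prob_space_axioms indep_vars_Pi_pmf]) auto
    fix i assume "i \<in> {..<m}"
    then have i: "i < m" by simp
    have "\<omega> i \<in> set_pmf D" if "\<omega> \<in> set_pmf ?P" for \<omega>
    proof -
      have "\<omega> i \<in> set_pmf (map_pmf (\<lambda>\<omega>. \<omega> i) ?P)"
        using that by auto
      then show ?thesis
        by (simp only: comp[OF i])
    qed
    then show "AE \<omega> in measure_pmf ?P. \<phi> (\<omega> i) \<in> {0..M}"
      using bnd by (simp add: AE_measure_pmf_iff)
  next
    have "(\<Sum>i<m. measure_pmf.expectation ?P (\<lambda>\<omega>. \<phi> (\<omega> i))) = real m * measure_pmf.expectation D \<phi>"
      using exp_comp by simp
    then show "real m * measure_pmf.expectation D \<phi> \<equiv>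
        \<Sum>i<m. measure_pmf.expectation ?P (\<lambda>\<omega>. \<phi> (\<omega> i))"
      by (simp add: eq_reflection)
  qed simp
  have "2 * (\<tau> * M * real m)\<^sup>2 / (real m * M\<^sup>2) = 2 * real m * \<tau>\<^sup>2"
    using pos by (simp add: power2_eq_square)
  then show ?thesis
    using Hoeffding_ineq_abs_ge[of "\<tau> * M * real m"] pos by simp
qed

text \<open>\<open>M\<close> is an upper bound for \<open>f\<close>, and \<open>\<tau>\<close> is the precision relative to it.\<close>

definition accurate :: "real \<Rightarrow> real \<Rightarrow> nat set pmf \<Rightarrow> (nat set \<Rightarrow> real) \<Rightarrow> (nat set \<Rightarrow> bool)
    \<Rightarrow> (nat set \<times> real) list \<Rightarrow> bool" where
  "accurate \<tau> M D f P xs \<longleftrightarrow>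
     \<bar>sum_list (map snd (filter (\<lambda>p. P (fst p)) xs))
        - real (length xs) * measure_pmf.expectation D (\<lambda>S. of_bool (P S) * f S)\<bar> \<le> \<tau> * M * real (length xs) \<and>
     \<bar>real (length (filter (\<lambda>p. P (fst p)) xs))
        - real (length xs) * measure_pmf.expectation D (\<lambda>S. of_bool (P S))\<bar> \<le> \<tau> * real (length xs)"

lemma set_pmf_samples_pmf:
  assumes "xs \<in> set_pmf (samples_pmf m D f)"
  shows "length xs = m" and "\<And>p. p \<in> set xs \<Longrightarrow> fst p \<in> set_pmf D \<and> snd p = f (fst p)"
  using assms unfolding samples_pmf_def
  by (auto simp: set_Pi_pmf PiE_dflt_def)

text \<open>A union bound over \<open>I\<close>. The factor 4 comes from two quantities per
  predicate, the sum and the count, each with a two-sided tail.\<close>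

lemma prob_accurate:
  fixes P :: "'i \<Rightarrow> nat set \<Rightarrow> bool"
  assumes bnd: "\<And>S. S \<in> set_pmf D \<Longrightarrow> 0 \<le> f S \<and> f S \<le> M"
    and pos: "0 < M" "0 < m" "0 \<le> \<tau>" and I: "finite I"
  shows "measure_pmf.prob (samples_pmf m D f) {xs. \<forall>i\<in>I. accurate \<tau> M D f (P i) xs}
     \<ge> 1 - 4 * real (card I) * exp (- 2 * real m * \<tau> ^ 2)"
proof -
  let ?Q = "Pi_pmf {..<m} {} (\<lambda>_. D)"
  let ?X = "\<lambda>\<omega>::nat \<Rightarrow> nat set. map (\<lambda>i. (\<omega> i, f (\<omega> i))) [0..<m]"
  define bad where "bad \<phi> b = {\<omega>::nat \<Rightarrow> nat set.
      \<tau> * b * real m \<le> \<bar>(\<Sum>i<m. \<phi> (\<omega> i)) - real m * measure_pmf.expectation D \<phi>\<bar>}"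
    for \<phi> :: "nat set \<Rightarrow> real" and b :: real
  define Bad where "Bad i = bad (\<lambda>S. of_bool (P i S) * f S) M \<union> bad (\<lambda>S. of_bool (P i S)) 1" for i
  have prob_Bad: "measure_pmf.prob ?Q (Bad i) \<le> 4 * exp (- 2 * real m * \<tau> ^ 2)" for i
  proof -
    have "measure_pmf.prob ?Q (bad (\<lambda>S. of_bool (P i S) * f S) M) \<le> 2 * exp (- 2 * real m * \<tau> ^ 2)"
      unfolding bad_def using bnd pos by (intro Pi_pmf_mean_concentration) (auto split: split_of_bool)
    moreover have "measure_pmf.prob ?Q (bad (\<lambda>S. of_bool (P i S)) 1) \<le> 2 * exp (- 2 * real m * \<tau> ^ 2)"
      unfolding bad_def using pos by (intro Pi_pmf_mean_concentration) auto
    ultimately show ?thesis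
      unfolding Bad_def using measure_Un_le[of _ "measure_pmf ?Q"] by (smt (verit) UNIV_I sets_measure_pmf)
  qed
  have "- (\<Union>i\<in>I. Bad i) \<subseteq> ?X -` {xs. \<forall>i\<in>I. accurate \<tau> M D f (P i) xs}"
  proof
    fix \<omega> assume \<omega>: "\<omega> \<in> - (\<Union>i\<in>I. Bad i)"
    have total: "sum_list (map snd (filter (\<lambda>p. P i (fst p)) (?X \<omega>))) = (\<Sum>j<m. of_bool (P i (\<omega> j)) * f (\<omega> j))" for i
    proof -
      have "sum_list (map snd (filter (\<lambda>p. P i (fst p)) (?X \<omega>)))
          = sum_list (map (\<lambda>j. of_bool (P i (\<omega> j)) * f (\<omega> j)) [0..<m])"
        by (induction m) auto
      then show ?thesis
        by (simp add: interv_sum_list_conv_sum_set_nat atLeast0LessThan)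
    qed
    have count: "real (length (filter (\<lambda>p. P i (fst p)) (?X \<omega>))) = (\<Sum>j<m. of_bool (P i (\<omega> j)))" for i
      by (induction m) auto
    have len: "length (?X \<omega>) = m"
      by simp
    have "accurate \<tau> M D f (P i) (?X \<omega>)" if "i \<in> I" for i
    proof -
      have "\<omega> \<notin> bad (\<lambda>S. of_bool (P i S) * f S) M" "\<omega> \<notin> bad (\<lambda>S. of_bool (P i S)) 1"
        using \<omega> that by (auto simp: Bad_def)
      then show ?thesis
        unfolding accurate_def total count len bad_def mem_Collect_eq not_le by (simp only: mult_1_right less_imp_le)
    qed
    then show "\<omega> \<in> ?X -` {xs. \<forall>i\<in>I. accurate \<tau> M D f (P i) xs}"
      by blast
  qed
  then have "measure_pmf.prob ?Q (- (\<Union>i\<in>I. Bad i))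
      \<le> measure_pmf.prob (samples_pmf m D f) {xs. \<forall>i\<in>I. accurate \<tau> M D f (P i) xs}"
    unfolding samples_pmf_def measure_map_pmf by (intro measure_pmf.finite_measure_mono) auto
  moreover have "measure_pmf.prob ?Q (- (\<Union>i\<in>I. Bad i)) = 1 - measure_pmf.prob ?Q (\<Union>i\<in>I. Bad i)"
    using measure_pmf.prob_compl[of "\<Union>i\<in>I. Bad i" ?Q] by (simp add: Compl_eq_Diff_UNIV)
  moreover have "measure_pmf.prob ?Q (\<Union>i\<in>I. Bad i) \<le> (\<Sum>i\<in>I. measure_pmf.prob ?Q (Bad i))"
    using I by (intro measure_pmf.finite_measure_subadditive_finite) auto
  moreover have "(\<Sum>i\<in>I. measure_pmf.prob ?Q (Bad i)) \<le> (\<Sum>i\<in>I. 4 * exp (- 2 * real m * \<tau> ^ 2))"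
    by (intro sum_mono prob_Bad)
  ultimately show ?thesis
    by simp
qed

text \<open>The empirical mean is a ratio \<open>s / l\<close> whose parts have targets
  \<open>m * A * C\<close> and \<open>m * C\<close>; \<open>C\<close> is the probability of
  \<open>P\<close> and \<open>A\<close> the conditional mean of \<open>f\<close>. Each error
  contributes at most \<open>M * \<tau> * m\<close> to \<open>s - A * l\<close>, and
  \<open>2 * \<tau> \<le> C\<close> keeps \<open>l\<close> at half its target or more.\<close>

lemma mean_list_accurate:
  assumes acc: "accurate \<tau> M D f P xs" and xs: "xs \<noteq> []"
    and C: "C = measure_pmf.expectation D (\<lambda>S. of_bool (P S))"
    and A: "A * C = measure_pmf.expectation D (\<lambda>S. of_bool (P S) * f S)"
    and bnds: "0 \<le> A" "A \<le> M" "0 < C" "0 \<le> \<tau>" "2 * \<tau> \<le> C"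
  shows "\<bar>mean_list (map snd (filter (\<lambda>p. P (fst p)) xs)) - A\<bar> \<le> 4 * M * \<tau> / C"
proof -
  define m where "m = real (length xs)"
  define s where "s = sum_list (map snd (filter (\<lambda>p. P (fst p)) xs))"
  define l where "l = real (length (filter (\<lambda>p. P (fst p)) xs))"
  have m: "m > 0"
    using xs by (simp add: m_def)
  have s: "\<bar>s - m * (A * C)\<bar> \<le> \<tau> * M * m" and l: "\<bar>l - m * C\<bar> \<le> \<tau> * m"
    using acc unfolding accurate_def s_def l_def m_def C[symmetric] A[symmetric] by auto
  have "2 * (\<tau> * m) \<le> m * C"
    using mult_left_mono[OF bnds(5), of m] m by (simp add: mult_ac)
  then have "m * C / 2 \<le> l"
    using l by (simp add: abs_le_iff)
  moreover have "m * C / 2 > 0"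
    using m bnds by simp
  ultimately have l0: "l > 0"
    by linarith
  have "\<bar>s - A * l\<bar> \<le> \<bar>s - m * (A * C)\<bar> + \<bar>A * (l - m * C)\<bar>"
    by (simp add: algebra_simps)
  also have "\<bar>A * (l - m * C)\<bar> = A * \<bar>l - m * C\<bar>"
    using bnds by (simp add: abs_mult)
  also have "\<dots> \<le> M * (\<tau> * m)"
    using bnds l by (intro mult_mono) auto
  finally have "\<bar>s - A * l\<bar> \<le> 2 * M * \<tau> * m"
    using s by (simp add: mult_ac)
  also have "\<dots> = 4 * M * \<tau> / C * (m * C / 2)"
    using bnds by simp
  also have "\<dots> \<le> 4 * M * \<tau> / C * l"
    using \<open>m * C / 2 \<le> l\<close> bnds by (intro mult_left_mono) auto
  finally have "\<bar>s - A * l\<bar> / l \<le> 4 * M * \<tau> / C"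
    using l0 by (simp add: divide_le_eq)
  moreover have "\<bar>s - A * l\<bar> / l = \<bar>(s - A * l) / l\<bar>"
    using l0 by (simp add: abs_divide)
  moreover have "(s - A * l) / l = s / l - A"
    using l0 by (simp add: diff_divide_distrib)
  ultimately have "\<bar>s / l - A\<bar> \<le> 4 * M * \<tau> / C"
    by metis
  then show ?thesis
    by (simp add: mean_list_def s_def l_def)
qed

section \<open>The sampling distribution and its restriction to one size\<close>

lemma set_pmf_unif_size: "finite N \<Longrightarrow> s \<le> card N \<Longrightarrow> set_pmf (unif_size N s) = ksubsets N s"
  unfolding unif_size_def using finite_ksubsets ksubsets_nonempty by (intro set_pmf_of_set) auto

lemma expectation_unif_size:
  "finite N \<Longrightarrow> s \<le> card N \<Longrightarrow> measure_pmf.expectation (unif_size N s) g = avg g N s"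
  unfolding unif_size_def avg_def using finite_ksubsets ksubsets_nonempty
  by (subst integral_pmf_of_set) (auto simp: n_subsets)

lemma set_pmf_D_sub:
  assumes "k \<le> n" "r + 1 \<le> n"
  shows "set_pmf (D_sub n r k) \<subseteq> Pow {..<n}"
  using assms by (auto simp: D_sub_def set_pmf_unif_size split: if_splits)

lemma expectation_D_sub:
  assumes "k \<le> n" "r + 1 \<le> n"
  shows "measure_pmf.expectation (D_sub n r k) g
    = (avg g {..<n} k + avg g {..<n} r + avg g {..<n} (r + 1)) / 3"
proof -
  have "measure_pmf.expectation (D_sub n r k) g = (\<Sum>t\<in>{0::nat, 1, 2}.
      measure_pmf.expectation (unif_size {..<n} (if t = 0 then k else if t = 1 then r else r + 1)) g
      /\<^sub>R real (card {0::nat, 1, 2}))"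
    unfolding D_sub_def using assms
    by (intro pmf_expectation_bind_pmf_of_set) (auto simp: set_pmf_unif_size finite_ksubsets)
  then show ?thesis
    using assms by (simp add: expectation_unif_size field_simps)
qed

lemma avg_restrict_size:
  assumes "finite A"
  shows "avg (\<lambda>S. of_bool (card S = s \<and> Q S) * g S) A t
    = (if t = s then (\<Sum>S\<in>{S \<in> ksubsets A s. Q S}. g S) / real (card A choose s) else 0)"
proof (cases "t = s")
  case True
  have "(\<Sum>S\<in>ksubsets A s. of_bool (card S = s \<and> Q S) * g S) = (\<Sum>S\<in>{S \<in> ksubsets A s. Q S}. g S)"
    by (rule sum.mono_neutral_cong_right) (auto simp: finite_ksubsets[OF assms])
  with True show ?thesis
    by (simp add: avg_def)
qed (auto simp: avg_def intro!: sum.neutral)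

text \<open>If two of the three sizes coincide, the distribution gives them double weight; conditioned on
  its size, a sample is uniform in any case.\<close>

lemma expectation_D_sub_restrict:
  assumes "k \<le> n" "r + 1 \<le> n" "s \<in> {k, r, r + 1}"
  obtains c where "c \<ge> 1 / 3" "\<And>Q g. measure_pmf.expectation (D_sub n r k) (\<lambda>S. of_bool (card S = s \<and> Q S) * g S)
      = c * ((\<Sum>S\<in>{S \<in> ksubsets {..<n} s. Q S}. g S) / real (n choose s))"
proof
  define c :: real where "c = (of_bool (k = s) + of_bool (r = s) + of_bool (r + 1 = s)) / 3"
  show "c \<ge> 1 / 3"
    using assms(3) by (auto simp: c_def)
  show "measure_pmf.expectation (D_sub n r k) (\<lambda>S. of_bool (card S = s \<and> Q S) * g S)
      = c * ((\<Sum>S\<in>{S \<in> ksubsets {..<n} s. Q S}. g S) / real (n choose s))" for Q g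
    unfolding expectation_D_sub[OF assms(1,2)] avg_restrict_size[OF finite_lessThan]
    by (simp add: c_def add_divide_distrib distrib_right)
qed

subsection \<open>The algorithm\<close>

lemma best_k_sample_in:
  assumes "K = filter (\<lambda>p. card (fst p) = k) xs" "K \<noteq> []"
  shows "\<exists>p\<in>set K. best_k_sample k xs = fst p \<and> snd p = Max (snd ` set K)"
proof -
  let ?L = "filter (\<lambda>p. snd p = Max (snd ` set K)) K"
  have "Max (snd ` set K) \<in> snd ` set K"
    using assms(2) by (intro Max_in) auto
  then have "?L \<noteq> []"
    by (force simp: filter_empty_conv)
  then have "hd ?L \<in> set ?L"
    by (rule hd_in_set)
  moreover have "best_k_sample k xs = fst (hd ?L)"
    using assms by (simp add: best_k_sample_def Let_def)
  ultimately show ?thesis by auto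
qed

lemma best_k_sample_ge:
  assumes vals: "\<And>p. p \<in> set xs \<Longrightarrow> snd p = f (fst p)" and p: "p \<in> set xs" "card (fst p) = k"
  shows "f (fst p) \<le> f (best_k_sample k xs)"
proof -
  define K where "K = filter (\<lambda>p. card (fst p) = k) xs"
  have pK: "p \<in> set K"
    using p by (simp add: K_def)
  then obtain q where q: "q \<in> set K" "best_k_sample k xs = fst q" "snd q = Max (snd ` set K)"
    using best_k_sample_in[OF K_def] by fastforce
  have "snd p \<le> snd q"
    using pK unfolding q(3) by (intro Max_ge) auto
  then show ?thesis
    using vals q p by (simp add: K_def)
qed

lemma card_best_k_sample: "card (best_k_sample k xs) \<le> k"
proof (cases "filter (\<lambda>p. card (fst p) = k) xs = []")
  case True
  then show ?thesis by (simp add: best_k_sample_def)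
next
  case False
  from best_k_sample_in[OF refl this] show ?thesis by auto
qed

lemma best_k_sample_subset:
  assumes "\<And>p. p \<in> set xs \<Longrightarrow> fst p \<subseteq> N"
  shows "best_k_sample k xs \<subseteq> N"
proof (cases "filter (\<lambda>p. card (fst p) = k) xs = []")
  case True
  then show ?thesis by (simp add: best_k_sample_def)
next
  case False
  from best_k_sample_in[OF refl this] obtain p where "p \<in> set xs" "best_k_sample k xs = fst p"
    by auto
  with assms show ?thesis by simp
qed

lemma bin_subset: "bin n r xs j \<subseteq> {..<n}"
  by (auto simp: bin_def Let_def)

lemma finite_bin: "finite (bin n r xs j)"
  by (rule finite_subset[OF bin_subset]) simp

lemma bin_branch_eq:
  "bin_branch n r k xs = (if num_bins n = 0 then return_pmf {} else
     pmf_of_set {1..num_bins n} \<bind> (\<lambda>j. unif_size (bin n r xs j) (min (card (bin n r xs j)) k)))"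
  by (simp add: bin_branch_def unif_size_def)

lemma set_pmf_bin_branch: "set_pmf (bin_branch n r k xs) \<subseteq> {T. T \<subseteq> {..<n} \<and> card T \<le> k}"
proof (cases "num_bins n = 0")
  case False
  show ?thesis
  proof
    fix T assume "T \<in> set_pmf (bin_branch n r k xs)"
    with False obtain j where "T \<in> set_pmf (unif_size (bin n r xs j) (min (card (bin n r xs j)) k))"
      by (auto simp: bin_branch_eq)
    then have "T \<subseteq> bin n r xs j" "card T \<le> k"
      by (auto simp: set_pmf_unif_size[OF finite_bin])
    with bin_subset[of n r xs j] show "T \<in> {T. T \<subseteq> {..<n} \<and> card T \<le> k}"
      by auto
  qed
qed (simp add: bin_branch_eq)

lemma finite_set_pmf_bin_branch: "finite (set_pmf (bin_branch n r k xs))"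
  by (rule finite_subset[OF set_pmf_bin_branch], rule finite_subset[of _ "Pow {..<n}"]) auto

lemma expectation_bin_branch:
  assumes "num_bins n \<noteq> 0"
  shows "measure_pmf.expectation (bin_branch n r k xs) f
    = (\<Sum>j\<in>{1..num_bins n}. avg f (bin n r xs j) (min (card (bin n r xs j)) k)) / real (num_bins n)"
proof -
  have "measure_pmf.expectation (bin_branch n r k xs) f = (\<Sum>j\<in>{1..num_bins n}.
      measure_pmf.expectation (unif_size (bin n r xs j) (min (card (bin n r xs j)) k)) f /\<^sub>R real (card {1..num_bins n}))"
    using assms by (simp only: bin_branch_eq if_False, intro pmf_expectation_bind_pmf_of_set)
      (auto simp: set_pmf_unif_size[OF finite_bin] finite_ksubsets[OF finite_bin])
  also have "\<dots> = (\<Sum>j\<in>{1..num_bins n}. avg f (bin n r xs j) (min (card (bin n r xs j)) k) / real (num_bins n))"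
    by (intro sum.cong refl) (simp add: expectation_unif_size[OF finite_bin] divide_inverse mult.commute)
  finally show ?thesis
    by (simp add: sum_divide_distrib)
qed

lemma set_pmf_ALG: "set_pmf (ALG n r k xs) = insert (best_k_sample k xs) (set_pmf (bin_branch n r k xs))"
  by (auto simp: ALG_def set_pmf_bernoulli split: if_splits)

lemma expectation_ALG:
  fixes f :: "nat set \<Rightarrow> real"
  shows "measure_pmf.expectation (ALG n r k xs) f
    = (f (best_k_sample k xs) + measure_pmf.expectation (bin_branch n r k xs) f) / 2"
  unfolding ALG_def using finite_set_pmf_bin_branch
  by (subst pmf_expectation_bind[of UNIV]) (auto simp: UNIV_bool add_divide_distrib)

text \<open>The event has probability at least \<open>1 / (3 * n)\<close>: size \<open>s\<close> has
  weight at least 1/3, and by \<open>frequent\<close> at least a fraction \<open>1 / n\<close> of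
  the \<open>s\<close>-sets satisfy \<open>Q\<close>. Hence \<open>6 * n * \<tau> \<le> 1\<close>
  yields \<open>2 * \<tau> \<le> C\<close>, and the error \<open>4 * M * \<tau> / C\<close> is at
  most \<open>12 * n * M * \<tau>\<close>.\<close>

lemma restricted_samples:
  fixes V :: real
  assumes kr: "k \<le> n" "r + 1 \<le> n" "s \<in> {k, r, r + 1}" and n: "n > 0"
    and acc: "accurate \<tau> M (D_sub n r k) f (\<lambda>S. card S = s \<and> Q S) xs" and xs: "xs \<noteq> []"
    and f: "\<And>S. S \<subseteq> {..<n} \<Longrightarrow> 0 \<le> f S \<and> f S \<le> M"
    and frequent: "n choose s \<le> n * card {S \<in> ksubsets {..<n} s. Q S}"
    and \<tau>: "0 \<le> \<tau>" "6 * real n * \<tau> \<le> 1" and s: "s \<le> n"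
  shows "filter (\<lambda>p. card (fst p) = s \<and> Q (fst p)) xs \<noteq> []"
    and "\<bar>mean_list (map snd (filter (\<lambda>p. card (fst p) = s \<and> Q (fst p)) xs))
      - (\<Sum>S\<in>{S \<in> ksubsets {..<n} s. Q S}. f S) / real (card {S \<in> ksubsets {..<n} s. Q S})\<bar> \<le> 12 * real n * M * \<tau>"
proof -
  let ?D = "D_sub n r k" and ?X = "{S \<in> ksubsets {..<n} s. Q S}"
  \<comment> \<open>The same \<open>c\<close> serves all \<open>Q\<close> and \<open>g\<close>, so
    it cancels from the conditional mean \<open>A\<close>.\<close>
  obtain c where c: "c \<ge> 1 / 3" and E: "\<And>Q g. measure_pmf.expectation ?D (\<lambda>S. of_bool (card S = s \<and> Q S) * g S)
      = c * ((\<Sum>S\<in>{S \<in> ksubsets {..<n} s. Q S}. g S) / real (n choose s))"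
    by (rule expectation_D_sub_restrict[OF kr]) (rule that)
  define C :: real where "C = measure_pmf.expectation ?D (\<lambda>S. of_bool (card S = s \<and> Q S))"
  define A where "A = (\<Sum>S\<in>?X. f S) / real (card ?X)"
  have choose: "real (n choose s) > 0"
    using s by simp
  have "real (n choose s) \<le> real n * real (card ?X)"
    using frequent by (simp flip: of_nat_mult)
  then have X: "1 / real n \<le> real (card ?X) / real (n choose s)"
    using choose n by (simp add: field_simps)
  have C_eq: "C = c * (real (card ?X) / real (n choose s))"
    using E[of Q "\<lambda>_. 1"] by (simp add: C_def)
  have "1 / 3 * (1 / real n) \<le> C"
    unfolding C_eq using c X by (intro mult_mono) auto
  then have C: "1 / (3 * real n) \<le> C"
    by simp
  then have C0: "C > 0"
    using n by (auto intro: less_le_trans[rotated])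
  have "card ?X \<noteq> 0"
  proof
    assume "card ?X = 0"
    then have "1 / real n \<le> 0"
      using X by (simp only: of_nat_0 div_0)
    with n show False by simp
  qed
  then have card0: "real (card ?X) > 0"
    by (simp only: of_nat_0_less_iff neq0_conv)
  have cancel: "a / x * (c * (x / y)) = c * (a / y)" if "x > 0" for a x y :: real
    using that by simp
  have AC: "A * C = measure_pmf.expectation ?D (\<lambda>S. of_bool (card S = s \<and> Q S) * f S)"
    unfolding E C_eq A_def by (rule cancel[OF card0])
  have A: "0 \<le> A" "A \<le> M"
  proof -
    show "0 \<le> A"
      unfolding A_def using f by (intro divide_nonneg_nonneg sum_nonneg) auto
    have "(\<Sum>S\<in>?X. f S) \<le> (\<Sum>S\<in>?X. M)"
      using f by (intro sum_mono) auto
    then show "A \<le> M"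
      unfolding A_def pos_divide_le_eq[OF card0] by (simp only: sum_constant mult.commute)
  qed
  have \<tau>C: "2 * \<tau> \<le> C"
  proof -
    have "2 * \<tau> \<le> 1 / (3 * real n)"
      using \<tau> n by (simp add: field_simps)
    with C show ?thesis by simp
  qed
  have "\<bar>mean_list (map snd (filter (\<lambda>p. card (fst p) = s \<and> Q (fst p)) xs)) - A\<bar> \<le> 4 * M * \<tau> / C"
    by (rule mean_list_accurate[OF acc xs C_def AC A C0 \<tau>(1) \<tau>C])
  also have "\<dots> \<le> 4 * M * \<tau> / (1 / (3 * real n))"
    using C C0 A \<tau> n by (intro divide_left_mono) auto
  finally show "\<bar>mean_list (map snd (filter (\<lambda>p. card (fst p) = s \<and> Q (fst p)) xs))
      - (\<Sum>S\<in>?X. f S) / real (card ?X)\<bar> \<le> 12 * real n * M * \<tau>"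
    unfolding A_def by (simp add: mult_ac)
  \<comment> \<open>Without such a sample the count condition would give
    \<open>C \<le> \<tau>\<close>, against \<open>2 * \<tau> \<le> C\<close> and
    \<open>C > 0\<close>.\<close>
  show "filter (\<lambda>p. card (fst p) = s \<and> Q (fst p)) xs \<noteq> []"
  proof
    assume "filter (\<lambda>p. card (fst p) = s \<and> Q (fst p)) xs = []"
    then have "real (length xs) * C \<le> \<tau> * real (length xs)"
      using acc C0 unfolding accurate_def C_def[symmetric] by simp
    then have "C \<le> \<tau>"
      using xs by simp
    then show False
      using \<tau>C C0 \<tau> by simp
  qed
qed

text \<open>A fraction \<open>s / n \<ge> 1 / n\<close> of the \<open>s\<close>-sets contains
  \<open>i\<close>.\<close>

lemma choose_le_mult_card_in:
  assumes "i < n" "1 \<le> s"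
  shows "n choose s \<le> n * card {S \<in> ksubsets {..<n} s. i \<in> S}"
proof -
  obtain t where t: "s = Suc t"
    using assms(2) by (cases s) auto
  have "n choose s \<le> Suc t * (n choose Suc t)"
    by (simp add: t)
  also have "\<dots> = n * ((n - 1) choose t)"
    by (rule binomial_absorption)
  finally show ?thesis
    using card_ksubsets_in[of "{..<n}" i t] assms(1) t by simp
qed

lemma choose_le_mult_card_notin:
  assumes "i < n" "s < n"
  shows "n choose s \<le> n * card {S \<in> ksubsets {..<n} s. i \<notin> S}"
proof -
  have "1 * (n choose s) \<le> (n - s) * (n choose s)"
    using assms(2) by (intro mult_right_mono) auto
  also have "\<dots> = n * ((n - 1) choose s)"
    by (rule binomial_absorb_comp)
  finally show ?thesis
    using card_ksubsets_notin[of "{..<n}" i s] assms(1) by simp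
qed

text \<open>The randomness of the samples enters only through these assumptions, so the analysis
  inside the locale is deterministic. The conjunct \<open>True\<close> gives \<open>acc_k\<close>
  the form \<open>card S = s \<and> Q S\<close> of the other conditions.\<close>

locale sampled_instance = monotone_submodular "{..<n}" f
  for n :: nat and f :: "nat set \<Rightarrow> real" +
  fixes r k :: nat and M \<tau> :: real and xs :: "(nat set \<times> real) list"
  assumes k: "1 \<le> k" "k \<le> n" and r: "r + 1 \<le> n"
    and bounded: "S \<subseteq> {..<n} \<Longrightarrow> f S \<le> M"
    and \<tau>: "0 \<le> \<tau>" "6 * real n * \<tau> \<le> 1"
    and samples: "xs \<noteq> []" "p \<in> set xs \<Longrightarrow> snd p = f (fst p)" "p \<in> set xs \<Longrightarrow> fst p \<subseteq> {..<n}"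
    and acc_in: "i < n \<Longrightarrow> accurate \<tau> M (D_sub n r k) f (\<lambda>S. card S = r + 1 \<and> i \<in> S) xs"
    and acc_notin: "i < n \<Longrightarrow> accurate \<tau> M (D_sub n r k) f (\<lambda>S. card S = r \<and> i \<notin> S) xs"
    and acc_k_in: "i < n \<Longrightarrow> accurate \<tau> M (D_sub n r k) f (\<lambda>S. card S = k \<and> i \<in> S) xs"
    and acc_k: "accurate \<tau> M (D_sub n r k) f (\<lambda>S. card S = k \<and> True) xs"
begin

lemma f_bounds: "S \<subseteq> {..<n} \<Longrightarrow> 0 \<le> f S \<and> f S \<le> M"
  using nonneg bounded by simp

lemma v_hat_error:
  assumes i: "i < n"
  shows "\<bar>v_hat r xs i - marginal r i\<bar> \<le> 24 * real n * M * \<tau>"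
proof -
  have n: "n > 0"
    using i by simp
  have "\<bar>mean_list (map snd (filter (\<lambda>p. card (fst p) = r + 1 \<and> i \<in> fst p) xs))
      - (\<Sum>S\<in>{S \<in> ksubsets {..<n} (r + 1). i \<in> S}. f S) / real (card {S \<in> ksubsets {..<n} (r + 1). i \<in> S})\<bar>
      \<le> 12 * real n * M * \<tau>"
    using r by (intro restricted_samples(2)[OF k(2) r _ n acc_in[OF i] samples(1) f_bounds _ \<tau>]
      choose_le_mult_card_in[OF i]) auto
  moreover have "\<bar>mean_list (map snd (filter (\<lambda>p. card (fst p) = r \<and> i \<notin> fst p) xs))
      - (\<Sum>S\<in>{S \<in> ksubsets {..<n} r. i \<notin> S}. f S) / real (card {S \<in> ksubsets {..<n} r. i \<notin> S})\<bar>
      \<le> 12 * real n * M * \<tau>"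
    using r by (intro restricted_samples(2)[OF k(2) r _ n acc_notin[OF i] samples(1) f_bounds _ \<tau>]
      choose_le_mult_card_notin[OF i]) auto
  moreover have "marginal r i =
    (\<Sum>Y\<in>{Y \<in> ksubsets {..<n} (r + 1). i \<in> Y}. f Y) / real (card {Y \<in> ksubsets {..<n} (r + 1). i \<in> Y})
    - (\<Sum>X\<in>{X \<in> ksubsets {..<n} r. i \<notin> X}. f X) / real (card {X \<in> ksubsets {..<n} r. i \<notin> X})"
    using marginal_eq_diff[of i r] i by simp
  ultimately show ?thesis
    unfolding v_hat_def by linarith
qed

text \<open>By accuracy some sample of size \<open>k\<close> contains \<open>i\<close>; monotonicity
  does the rest.\<close>

lemma best_ge_singleton:
  assumes i: "i < n"
  shows "f {i} \<le> f (best_k_sample k xs)"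
proof -
  have n: "n > 0"
    using i by simp
  have "filter (\<lambda>p. card (fst p) = k \<and> i \<in> fst p) xs \<noteq> []"
    using k by (intro restricted_samples(1)[OF k(2) r _ n acc_k_in[OF i] samples(1) f_bounds _ \<tau>]
      choose_le_mult_card_in[OF i]) auto
  then obtain p where p: "p \<in> set xs" "card (fst p) = k" "i \<in> fst p"
    by (auto simp: filter_empty_conv)
  have "f {i} \<le> f (fst p)"
    using p samples(3)[OF p(1)] by (intro f_mono) auto
  also have "\<dots> \<le> f (best_k_sample k xs)"
    using p by (intro best_k_sample_ge samples)
  finally show ?thesis .
qed

lemma best_subset: "best_k_sample k xs \<subseteq> {..<n}"
  using samples by (intro best_k_sample_subset)

text \<open>The samples of size \<open>k\<close> have total value at most \<open>length xs\<close>
  times the best one. In expectation this total is at least \<open>length xs\<close> times a third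
  of the mean, as size \<open>k\<close> has weight at least 1/3.\<close>

lemma best_ge_avg: "avg f {..<n} k / 3 - \<tau> * M \<le> f (best_k_sample k xs)"
proof -
  let ?b = "f (best_k_sample k xs)" and ?D = "D_sub n r k"
  let ?K = "filter (\<lambda>p. card (fst p) = k \<and> True) xs"
  obtain c where c: "c \<ge> 1 / 3" and E: "\<And>Q g. measure_pmf.expectation ?D (\<lambda>S. of_bool (card S = k \<and> Q S) * g S)
      = c * ((\<Sum>S\<in>{S \<in> ksubsets {..<n} k. Q S}. g S) / real (n choose k))"
    by (rule expectation_D_sub_restrict[OF k(2) r, of k]) (simp, rule that)
  have "avg f {..<n} k / 3 \<le> c * avg f {..<n} k"
    using mult_right_mono[OF c avg_nonneg[of "{..<n}" k]] by simp
  also have "\<dots> = measure_pmf.expectation ?D (\<lambda>S. of_bool (card S = k \<and> True) * f S)"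
    using E[of "\<lambda>_. True" f] by (simp add: avg_def)
  finally have "real (length xs) * (avg f {..<n} k / 3)
      \<le> real (length xs) * measure_pmf.expectation ?D (\<lambda>S. of_bool (card S = k \<and> True) * f S)"
    by (intro mult_left_mono) auto
  also have "\<dots> \<le> sum_list (map snd ?K) + \<tau> * M * real (length xs)"
    using acc_k unfolding accurate_def by (simp add: abs_le_iff)
  also have "sum_list (map snd ?K) \<le> sum_list (map (\<lambda>_. ?b) ?K)"
  proof (rule sum_list_mono)
    fix p assume "p \<in> set ?K"
    then show "snd p \<le> ?b"
      using best_k_sample_ge[of xs f p k] samples(2) by auto
  qed
  also have "\<dots> = real (length ?K) * ?b"
    by (simp add: sum_list_triv)
  also have "\<dots> \<le> real (length xs) * ?b"
    using nonneg[OF best_subset] by (intro mult_right_mono) auto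
  finally have "real (length xs) * (avg f {..<n} k / 3) \<le> real (length xs) * (?b + \<tau> * M)"
    by (simp add: algebra_simps)
  then show ?thesis
    using samples(1) by simp
qed

end

text \<open>The threshold is \<open>384 ^ 2\<close>: \<open>J \<le> 6 * ln n\<close> and
  \<open>ln n \<le> 2 * sqrt n\<close> give \<open>32 * J \<le> 384 * sqrt n\<close>, which from
  there on is at most \<open>n\<close>.\<close>

lemma num_bins_bounds:
  assumes "147456 \<le> n"
  shows "1 \<le> num_bins n" "real n ^ 3 \<le> 2 ^ num_bins n" "32 * num_bins n \<le> n"
    "real (num_bins n) \<le> 6 * ln (real n)"
proof -
  let ?J = "num_bins n"
  have n: "real n \<ge> 147456"
    using assms by simp
  have ln1: "ln (real n) \<ge> 1"
    using n exp_le by (subst ln_ge_iff) auto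
  have log: "log 2 (real n) \<ge> 0"
    using n by simp
  have J: "3 * log 2 (real n) \<le> real ?J" "real ?J \<le> 3 * log 2 (real n) + 1"
    unfolding num_bins_def using log by linarith+
  have "log 2 (real n) > 0"
    using n by simp
  with J(1) show "1 \<le> ?J"
    by (cases ?J) auto
  have "real n ^ 3 = 2 powr (3 * log 2 (real n))"
  proof -
    have "2 powr (3 * log 2 (real n)) = (2 powr log 2 (real n)) powr 3"
      by (simp add: powr_powr mult.commute)
    also have "\<dots> = real n ^ 3"
      using n by simp
    finally show ?thesis by simp
  qed
  also have "\<dots> \<le> 2 powr real ?J"
    using J(1) by simp
  finally show "real n ^ 3 \<le> 2 ^ ?J"
    by (simp add: powr_realpow)
  \<comment> \<open>\<open>ln 2 \<ge> 2 / 3\<close> gives \<open>J \<le> 4.5 * ln n + 1\<close>, and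
    \<open>ln n \<ge> 1\<close> absorbs the summand 1.\<close>
  have "log 2 (real n) \<le> ln (real n) / (2 / 3)"
    unfolding log_def using ln1 ln2_ge_two_thirds by (intro divide_left_mono) auto
  with J(2) ln1 show J6: "real ?J \<le> 6 * ln (real n)"
    by simp
  have "ln (real n) = 2 * ln (sqrt (real n))"
    using n by (simp add: ln_sqrt)
  also have "\<dots> \<le> 2 * sqrt (real n)"
    using n ln_bound[of "sqrt (real n)"] by simp
  finally have "32 * real ?J \<le> 384 * sqrt (real n)"
    using J6 by simp
  also have "\<dots> \<le> sqrt (real n) * sqrt (real n)"
  proof (rule mult_right_mono)
    have "sqrt (384 ^ 2) \<le> sqrt (real n)"
      using n by (intro real_sqrt_le_mono) simp
    then show "384 \<le> sqrt (real n)"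
      by simp
  qed simp
  also have "\<dots> = real n"
    by simp
  finally have "real (32 * ?J) \<le> real n"
    by simp
  then show "32 * ?J \<le> n"
    by (simp only: of_nat_le_iff)
qed

section \<open>Value of the algorithm and its success probability\<close>

lemma OPT_attained:
  assumes "k \<le> n"
  shows "\<exists>T \<subseteq> {..<n}. card T \<le> k \<and> f T = OPT n k f"
    and "T \<subseteq> {..<n} \<Longrightarrow> card T \<le> k \<Longrightarrow> f T \<le> OPT n k f"
proof -
  have fin: "finite {T. T \<subseteq> {..<n} \<and> card T \<le> k}"
    by (rule finite_subset[of _ "Pow {..<n}"]) auto
  moreover have "{} \<in> {T. T \<subseteq> {..<n} \<and> card T \<le> k}"
    by simp
  ultimately have "OPT n k f \<in> f ` {T. T \<subseteq> {..<n} \<and> card T \<le> k}"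
    unfolding OPT_def by (intro Max_in) auto
  then show "\<exists>T \<subseteq> {..<n}. card T \<le> k \<and> f T = OPT n k f"
    by auto
  show "f T \<le> OPT n k f" if "T \<subseteq> {..<n}" "card T \<le> k"
    unfolding OPT_def using fin that by (intro Max_ge) auto
qed

text \<open>Both branches have nonnegative value, so one good branch suffices. One factor
  \<open>J\<close> is lost in \<open>good_bin_exists\<close>, the other in drawing the bin
  uniformly; \<open>128 = 2 * 64\<close> accounts for the fair coin.\<close>

lemma (in sampled_instance) ALG_value:
  assumes n: "147456 \<le> n" "n = r ^ 2" and V: "V = OPT n k f" "0 < V"
    and M: "M = real n * V" and \<tau>_eq: "\<tau> = 1 / real n ^ 5"
  shows "V / (128 * real (num_bins n) ^ 2 * sqrt (real r)) \<le> measure_pmf.expectation (ALG n r k xs) f"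
proof -
  let ?J = "num_bins n" and ?s = "sqrt (real r)" and ?best = "f (best_k_sample k xs)"
  let ?branch = "measure_pmf.expectation (bin_branch n r k xs) f"
  note J = num_bins_bounds[OF n(1)]
  have J1: "real ?J \<ge> 1"
    using J(1) by simp
  have n0: "real n \<ge> 147456"
    using n(1) by simp
  have r1: "1 \<le> r" "real n = real r * real r"
  proof -
    have "r \<noteq> 0"
      by (rule notI) (use n in simp)
    then show "1 \<le> r" by simp
    show "real n = real r * real r"
      by (subst n(2)) (simp add: power2_eq_square)
  qed
  have s: "?s \<ge> 1" "?s \<le> real n"
  proof -
    show "?s \<ge> 1"
      using r1 by simp
    have "?s \<le> sqrt (real r ^ 2)"
      using r1 by (intro real_sqrt_le_mono) (simp add: power2_eq_square)
    also have "\<dots> \<le> real r * real r"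
      using r1(1) by simp
    finally show "?s \<le> real n"
      using r1 by simp
  qed
  obtain T where T: "T \<subseteq> {..<n}" "card T \<le> k" "f T = V"
    using OPT_attained(1)[OF k(2), of f] V by auto
  have single: "f {i} \<le> V" if "i \<in> {..<n}" for i
    unfolding V(1) using that k by (intro OPT_attained) auto
  have est: "\<bar>v_hat r xs i - marginal r i\<bar> \<le> V / real n ^ 2" if "i \<in> {..<n}" for i
  proof -
    have "24 * real n * M * \<tau> = 24 / real n * (V / real n ^ 2)"
      unfolding M \<tau>_eq using n0 by (simp add: power_numeral_reduce)
    also have "\<dots> \<le> 1 * (V / real n ^ 2)"
      using n0 V by (intro mult_right_mono) auto
    finally show ?thesis
      using v_hat_error[of i] that by simp
  qed
  have best0: "0 \<le> ?best"
    using best_subset by (rule nonneg)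
  have avgs0: "0 \<le> avg f (bin n r xs j) t" for j t
    using bin_subset by (rule avg_nonneg)
  have branch: "?branch = (\<Sum>j\<in>{1..?J}. avg f (bin n r xs j) (min (card (bin n r xs j)) k)) / real ?J"
    using J(1) by (intro expectation_bin_branch) auto
  have branch0: "0 \<le> ?branch"
    unfolding branch by (intro divide_nonneg_nonneg sum_nonneg avgs0) auto
  have "V / (64 * real ?J ^ 2 * ?s) \<le> ?best \<or> V / (64 * real ?J ^ 2 * ?s) \<le> ?branch"
  proof (cases "avg f {..<n} r \<le> V / 2")
    case True
    have "\<exists>j\<in>{1..?J}. V / (64 * real ?J * ?s) \<le> avg f (bin n r xs j) (min (card (bin n r xs j)) k)"
    proof (rule good_bin_exists[OF _ _ n(2) k T V(2) single True est J(1,2,3)])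
      show "bin n r xs j = {i \<in> {..<n}. Max (v_hat r xs ` {..<n}) / 2 ^ j < v_hat r xs i
          \<and> v_hat r xs i \<le> Max (v_hat r xs ` {..<n}) / 2 ^ (j - 1)}" for j
        by (simp add: bin_def Let_def)
    qed (use n(1) in auto)
    then obtain j where j: "j \<in> {1..?J}"
      and "V / (64 * real ?J * ?s) \<le> avg f (bin n r xs j) (min (card (bin n r xs j)) k)" (is "?l \<le> ?a j")
      by blast
    note this(2)
    also have "?a j \<le> (\<Sum>j\<in>{1..?J}. ?a j)"
      using j avgs0 by (intro member_le_sum) auto
    finally have "?l / real ?J \<le> ?branch"
      unfolding branch by (intro divide_right_mono) auto
    then show ?thesis
      by (simp add: power2_eq_square mult_ac)
  next
    case False
    then have large: "V / 2 \<le> avg f {..<n} r"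
      by simp
    have le: "V / (64 * real ?J ^ 2 * ?s) \<le> V / (12 * ?s)"
    proof (rule divide_left_mono)
      have "1 \<le> real ?J ^ 2"
        using J1 by simp
      then show "12 * ?s \<le> 64 * real ?J ^ 2 * ?s"
        using s by (intro mult_right_mono) auto
    qed (use V s J1 in auto)
    \<comment> \<open>For a good random \<open>k\<close>-set, \<open>best_ge_avg\<close> leaves a
      third of \<open>V / (2 * ?s)\<close> minus \<open>\<tau> * M\<close>, that is at least
      \<open>V / (6 * ?s) - V / (12 * ?s)\<close>.\<close>
    have "V / (12 * ?s) \<le> ?best"
      using avg_k_or_singleton[OF card_lessThan n(2) k r1(1) T large]
    proof (elim disjE)
      assume "\<exists>i\<in>{..<n}. V / ?s \<le> f {i}"
      then obtain i where i: "i < n" "V / ?s \<le> f {i}"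
        by auto
      have "V / (12 * ?s) \<le> V / ?s"
        using V s by (intro divide_left_mono) auto
      with i best_ge_singleton[OF i(1)] show ?thesis
        by linarith
    next
      assume avg: "V / (2 * ?s) \<le> avg f {..<n} k"
      have "\<tau> * M = V / real n ^ 4"
        unfolding M \<tau>_eq using n0 by (simp add: power_numeral_reduce)
      also have "\<dots> \<le> V / (12 * ?s)"
      proof (rule divide_left_mono)
        have "12 * ?s \<le> real n * real n"
          using n0 s by (intro mult_mono) auto
        also have "\<dots> \<le> real n ^ 4"
          using n0 power_increasing[of 2 4 "real n"] by (simp add: power2_eq_square)
        finally show "12 * ?s \<le> real n ^ 4" .
      qed (use V s n0 in auto)
      finally have "\<tau> * M \<le> V / (12 * ?s)" .
      moreover have "V / (12 * ?s) = V / (2 * ?s) / 3 - V / (12 * ?s)"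
        using s by (simp add: field_simps)
      ultimately show ?thesis
        using avg best_ge_avg by linarith
    qed
    with le show ?thesis by linarith
  qed
  then have "V / (64 * real ?J ^ 2 * ?s) \<le> ?best + ?branch"
    using best0 branch0 by linarith
  then show ?thesis
    unfolding expectation_ALG by (simp add: mult_ac)
qed

text \<open>The exponent is \<open>- 2 * n ^ (13 - 10)\<close>. By
  \<open>exp (- x) \<le> 1 / x\<close> the product is at most \<open>8 / n ^ 2\<close>, where
  \<open>8 / n \<le> 1\<close> and \<open>1 / n \<le> \<delta>\<close>.\<close>

lemma failure_probability_le:
  assumes "147456 \<le> n" "1 / \<delta> \<le> real n" "0 < \<delta>"
  shows "4 * real (4 * n) * exp (- 2 * real (n ^ 13) * (1 / real n ^ 5) ^ 2) \<le> \<delta>"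
proof -
  have n: "real n \<ge> 147456"
    using assms by simp
  have "- 2 * real (n ^ 13) * (1 / real n ^ 5) ^ 2 = - (2 * real n ^ 3)"
    using n by (simp add: field_simps flip: power_mult power_add)
  moreover have "exp (- (2 * real n ^ 3)) \<le> 1 / (2 * real n ^ 3)"
  proof -
    have "2 * real n ^ 3 \<le> exp (2 * real n ^ 3)"
      using exp_ge_add_one_self[of "2 * real n ^ 3"] by linarith
    then show ?thesis
      using n by (simp add: exp_minus field_simps)
  qed
  ultimately have "4 * real (4 * n) * exp (- 2 * real (n ^ 13) * (1 / real n ^ 5) ^ 2)
      \<le> 4 * real (4 * n) * (1 / (2 * real n ^ 3))"
    by (simp only:) (intro mult_left_mono, auto)
  also have "\<dots> = 8 / real n * (1 / real n)"
    using n by (simp add: field_simps power3_eq_cube)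
  also have "\<dots> \<le> 1 * \<delta>"
    using n assms by (intro mult_mono) (auto simp: field_simps)
  finally show ?thesis by simp
qed

text \<open>The four families of conditions in \<open>sampled_instance\<close> are indexed by pairs
  with \<open>t < 4\<close>, so that one union bound over \<open>4 * n\<close> predicates covers
  them all.\<close>

definition tracked :: "nat \<Rightarrow> nat \<Rightarrow> nat \<times> nat \<Rightarrow> nat set \<Rightarrow> bool" where
  "tracked r k q = (case q of (i, t) \<Rightarrow>
     [\<lambda>S. card S = r + 1 \<and> i \<in> S, \<lambda>S. card S = r \<and> i \<notin> S, \<lambda>S. card S = k \<and> i \<in> S, \<lambda>S. card S = k \<and> True] ! t)"

lemma ALG_value_whp:
  assumes n: "147456 \<le> n" "n = r ^ 2" "1 / \<delta> \<le> real n" and \<delta>: "0 < \<delta>" and k: "1 \<le> k" "k \<le> n"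
    and f: "monotone_submodular {..<n} f"
  shows "1 - \<delta> \<le> measure_pmf.prob (samples_pmf (n ^ 13) (D_sub n r k) f)
    {xs. (\<forall>S \<in> set_pmf (ALG n r k xs). card S \<le> k) \<and>
      OPT n k f / (128 * real (num_bins n) ^ 2 * sqrt (real r)) \<le> measure_pmf.expectation (ALG n r k xs) f}"
    (is "_ \<le> measure_pmf.prob ?P ?E")
proof -
  interpret monotone_submodular "{..<n}" f
    by (rule f)
  define V where "V = OPT n k f"
  have r: "r + 1 \<le> n"
  proof -
    have "r \<ge> 2"
    proof (rule ccontr)
      assume "\<not> r \<ge> 2"
      then have "r = 0 \<or> r = 1" by auto
      with n show False by auto
    qed
    then have "r + 1 \<le> 2 * r" by simp
    also have "\<dots> \<le> r * r"
      using \<open>r \<ge> 2\<close> by (intro mult_right_mono) auto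
    finally show ?thesis
      using n(2) by (simp add: power2_eq_square)
  qed
  have card_le: "\<forall>S \<in> set_pmf (ALG n r k xs). card S \<le> k" for xs
    unfolding set_pmf_ALG using card_best_k_sample set_pmf_bin_branch by blast
  have supp: "fst p \<subseteq> {..<n} \<and> snd p = f (fst p)" if "xs \<in> set_pmf ?P" "p \<in> set xs" for xs p
    using set_pmf_samples_pmf(2)[OF that] set_pmf_D_sub[OF k(2) r] by auto
  have OPT: "f S \<le> V" if "S \<subseteq> {..<n}" "card S \<le> k" for S
    unfolding V_def using that k by (intro OPT_attained)
  have V0: "V \<ge> 0"
    using OPT[of "{}"] nonneg[of "{}"] by simp
  show ?thesis
  \<comment> \<open>The concentration bound requires \<open>M > 0\<close>. For \<open>V = 0\<close>
    the guarantee is just nonnegativity of \<open>f\<close>.\<close>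
  proof (cases "V = 0")
    case True
    have "set_pmf ?P \<subseteq> ?E"
    proof
      fix xs assume xs: "xs \<in> set_pmf ?P"
      have "0 \<le> f S" if "S \<in> set_pmf (ALG n r k xs)" for S
        using that best_k_sample_subset[of xs "{..<n}" k] supp[OF xs] set_pmf_bin_branch[of n r k xs]
        unfolding set_pmf_ALG by (intro nonneg) blast
      then have "0 \<le> measure_pmf.expectation (ALG n r k xs) f"
        by (intro integral_nonneg_AE) (simp add: AE_measure_pmf_iff)
      then show "xs \<in> ?E"
        using True card_le by (simp add: V_def)
    qed
    then have "measure_pmf.prob ?P ?E = 1"
      by (subst measure_pmf.prob_eq_1) (auto simp: AE_measure_pmf_iff)
    with \<delta> show ?thesis by simp
  next
    case False
    with V0 have V: "V > 0" by simp
    define M where "M = real n * V"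
    define \<tau> where "\<tau> = 1 / real n ^ 5"
    have n0: "real n \<ge> 147456"
      using n(1) by simp
    have bounded: "f S \<le> M" if "S \<subseteq> {..<n}" for S
      unfolding M_def using that n(1) k card_mono[of "{..<n}" S]
      by (intro value_le_card_mult OPT) (auto simp: lessThan_empty_iff)
    let ?I = "{..<n} \<times> {..<4::nat}"
    let ?G = "{xs. \<forall>q\<in>?I. accurate \<tau> M (D_sub n r k) f (tracked r k q) xs}"
    have "1 - \<delta> \<le> 1 - 4 * real (card ?I) * exp (- 2 * real (n ^ 13) * \<tau> ^ 2)"
      using failure_probability_le[OF n(1,3) \<delta>] by (simp add: \<tau>_def mult.commute)
    also have "\<dots> \<le> measure_pmf.prob ?P ?G"
      using bounded nonneg set_pmf_D_sub[OF k(2) r] V n0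
      by (intro prob_accurate) (auto simp: M_def \<tau>_def)
    \<comment> \<open>On the support the list has length \<open>n ^ 13\<close> and records the
      values of \<open>f\<close> on subsets of the ground set.\<close>
    also have "\<dots> = measure_pmf.prob ?P (?G \<inter> set_pmf ?P)"
      by (rule measure_Int_set_pmf[symmetric])
    also have "\<dots> \<le> measure_pmf.prob ?P ?E"
    proof (rule measure_pmf.finite_measure_mono)
      show "?G \<inter> set_pmf ?P \<subseteq> ?E"
      proof
        fix xs assume "xs \<in> ?G \<inter> set_pmf ?P"
        then have xs: "xs \<in> set_pmf ?P"
          and acc: "\<And>i t. i < n \<Longrightarrow> t < 4 \<Longrightarrow> accurate \<tau> M (D_sub n r k) f (tracked r k (i, t)) xs"
          by auto
        have "sampled_instance n f r k M \<tau> xs"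
        proof unfold_locales
          have "real n \<le> real n ^ 4"
            using n0 by (intro self_le_power) auto
          then have "6 \<le> real n ^ 4"
            using n0 by linarith
          have "6 * real n * \<tau> = 6 / real n ^ 4"
            unfolding \<tau>_def using n0 by (simp add: power_numeral_reduce)
          also have "\<dots> \<le> 1"
            using \<open>6 \<le> real n ^ 4\<close> by (simp add: divide_le_eq)
          finally show "6 * real n * \<tau> \<le> 1" .
          show "xs \<noteq> []"
            using set_pmf_samples_pmf(1)[OF xs] n(1) by auto
          show "accurate \<tau> M (D_sub n r k) f (\<lambda>S. card S = r + 1 \<and> i \<in> S) xs" if "i < n" for i
            using acc[OF that, of 0] by (simp add: tracked_def)
          show "accurate \<tau> M (D_sub n r k) f (\<lambda>S. card S = r \<and> i \<notin> S) xs" if "i < n" for i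
            using acc[OF that, of 1] by (simp add: tracked_def)
          show "accurate \<tau> M (D_sub n r k) f (\<lambda>S. card S = k \<and> i \<in> S) xs" if "i < n" for i
            using acc[OF that, of 2] by (simp add: tracked_def)
          show "accurate \<tau> M (D_sub n r k) f (\<lambda>S. card S = k \<and> True) xs"
            using acc[of 0 3] n(1) by (simp add: tracked_def numeral_3_eq_3)
        qed (use k r bounded supp[OF xs] in \<open>auto simp: \<tau>_def\<close>)
        then have "V / (128 * real (num_bins n) ^ 2 * sqrt (real r)) \<le> measure_pmf.expectation (ALG n r k xs) f"
          using n V by (intro sampled_instance.ALG_value) (auto simp: M_def \<tau>_def V_def)
        then show "xs \<in> ?E"
          using card_le by (simp add: V_def)
      qed
    qed simp
    finally show ?thesis .
  qed
qed

text \<open>Adding a constant to \<open>f\<close> preserves monotonicity and submodularity but not a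
  multiplicative guarantee; hence the hypothesis of nonnegativity.\<close>

theorem theorem3:
  shows "\<exists>c > 0. \<exists>d::nat. \<forall>\<delta>::real. 0 < \<delta> \<and> \<delta> < 1 \<longrightarrow>
    (\<exists>n0::nat. \<exists>a b::nat. \<exists>m::nat \<Rightarrow> nat. (\<forall>n. m n \<le> a * n ^ b + a) \<and>
      (\<forall>n r k (f :: nat set \<Rightarrow> real).
         n \<ge> n0 \<longrightarrow> n = r ^ 2 \<longrightarrow> 1 \<le> k \<longrightarrow> k \<le> n \<longrightarrow>
         monotone_sf {..<n} f \<longrightarrow> submodular_sf {..<n} f \<longrightarrow>
         (\<forall>S. S \<subseteq> {..<n} \<longrightarrow> f S \<ge> 0) \<longrightarrow>
         measure_pmf.prob (samples_pmf (m n) (D_sub n r k) f)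
           {xs. (\<forall>S \<in> set_pmf (ALG n r k xs). card S \<le> k) \<and>
                measure_pmf.expectation (ALG n r k xs) f
                  \<ge> c * real n powr (-1/4) / (ln (real n)) ^ d * OPT n k f}
         \<ge> 1 - \<delta>))"
proof -
  have main: "1 - \<delta> \<le> measure_pmf.prob (samples_pmf (n ^ 13) (D_sub n r k) f)
      {xs. (\<forall>S \<in> set_pmf (ALG n r k xs). card S \<le> k) \<and>
        measure_pmf.expectation (ALG n r k xs) f \<ge> (1 / 4608) * real n powr (-1/4) / (ln (real n)) ^ 2 * OPT n k f}"
    if \<delta>: "0 < \<delta>" and n: "max 147456 (nat \<lceil>1 / \<delta>\<rceil>) \<le> n" "n = r ^ 2" and k: "1 \<le> k" "k \<le> n"
      and f: "monotone_sf {..<n} f" "submodular_sf {..<n} f" "\<forall>S. S \<subseteq> {..<n} \<longrightarrow> f S \<ge> 0"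
    for \<delta> :: real and n r k :: nat and f :: "nat set \<Rightarrow> real"
  proof -
    have n0: "147456 \<le> n" "1 / \<delta> \<le> real n"
      using n(1) by linarith+
    have ms: "monotone_submodular {..<n} f"
      using f by unfold_locales auto
    interpret monotone_submodular "{..<n}" f
      by (rule ms)
    have r0: "real r > 0"
      using n0(1) n(2) by (cases r) auto
    have root: "real n powr (-1/4) = 1 / sqrt (real r)"
    proof -
      have "real n = real r powr 2"
        by (subst n(2)) (use r0 in simp)
      then have "real n powr (-1/4) = real r powr (-(1/2))"
        by (simp only: powr_powr) simp
      also have "\<dots> = 1 / sqrt (real r)"
        by (simp add: powr_minus powr_half_sqrt inverse_eq_divide)
      finally show ?thesis .
    qed
    have V0: "OPT n k f \<ge> 0"
      using OPT_attained(2)[OF k(2), of "{}" f] nonneg[of "{}"] by simp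
    have J: "1 \<le> real (num_bins n)" "real (num_bins n) \<le> 6 * ln (real n)"
      using num_bins_bounds(1,4)[OF n0(1)] by auto
    \<comment> \<open>The constant is \<open>4608 = 128 * 6 ^ 2\<close>, with the 6 from
      \<open>J \<le> 6 * ln n\<close>; the square is the exponent \<open>d = 2\<close>.\<close>
    have "real (num_bins n) ^ 2 \<le> (6 * ln (real n)) ^ 2"
      using J by (intro power_mono) auto
    then have "128 * real (num_bins n) ^ 2 * sqrt (real r) \<le> 4608 * ln (real n) ^ 2 * sqrt (real r)"
      by (intro mult_right_mono) (auto simp: power_mult_distrib)
    then have "OPT n k f / (4608 * ln (real n) ^ 2 * sqrt (real r))
        \<le> OPT n k f / (128 * real (num_bins n) ^ 2 * sqrt (real r))"
      using V0 J r0 by (intro divide_left_mono) auto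
    moreover have "(1 / 4608) * real n powr (-1/4) / (ln (real n)) ^ 2 * OPT n k f
        = OPT n k f / (4608 * ln (real n) ^ 2 * sqrt (real r))"
      unfolding root by simp
    ultimately have "(1 / 4608) * real n powr (-1/4) / (ln (real n)) ^ 2 * OPT n k f
        \<le> OPT n k f / (128 * real (num_bins n) ^ 2 * sqrt (real r))"
      by simp
    then have "measure_pmf.prob (samples_pmf (n ^ 13) (D_sub n r k) f)
        {xs. (\<forall>S \<in> set_pmf (ALG n r k xs). card S \<le> k) \<and>
          OPT n k f / (128 * real (num_bins n) ^ 2 * sqrt (real r)) \<le> measure_pmf.expectation (ALG n r k xs) f}
      \<le> measure_pmf.prob (samples_pmf (n ^ 13) (D_sub n r k) f)
        {xs. (\<forall>S \<in> set_pmf (ALG n r k xs). card S \<le> k) \<and>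
          measure_pmf.expectation (ALG n r k xs) f \<ge> (1 / 4608) * real n powr (-1/4) / (ln (real n)) ^ 2 * OPT n k f}"
      by (intro measure_pmf.finite_measure_mono) auto
    with ALG_value_whp[OF n0(1) n(2) n0(2) \<delta> k ms] show ?thesis
      by linarith
  qed
  have poly: "\<forall>n. n ^ 13 \<le> (1::nat) * n ^ 13 + 1"
    by simp
  \<comment> \<open>Only the threshold \<open>n0\<close> depends on \<open>\<delta>\<close>; it
    ensures \<open>1 / \<delta> \<le> n\<close>.\<close>
  show ?thesis
  proof (rule exI[of _ "1 / 4608"], rule conjI, simp, rule exI[of _ 2], intro allI impI, elim conjE)
    fix \<delta> :: real
    assume "0 < \<delta>"
    then show "\<exists>n0 a b m. (\<forall>n. m n \<le> a * n ^ b + a) \<and>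
      (\<forall>n r k (f :: nat set \<Rightarrow> real).
         n \<ge> n0 \<longrightarrow> n = r ^ 2 \<longrightarrow> 1 \<le> k \<longrightarrow> k \<le> n \<longrightarrow>
         monotone_sf {..<n} f \<longrightarrow> submodular_sf {..<n} f \<longrightarrow>
         (\<forall>S. S \<subseteq> {..<n} \<longrightarrow> f S \<ge> 0) \<longrightarrow>
         measure_pmf.prob (samples_pmf (m n) (D_sub n r k) f)
           {xs. (\<forall>S \<in> set_pmf (ALG n r k xs). card S \<le> k) \<and>
                measure_pmf.expectation (ALG n r k xs) f
                  \<ge> 1 / 4608 * real n powr (-1/4) / (ln (real n)) ^ 2 * OPT n k f}
         \<ge> 1 - \<delta>)"
      using poly main
      by (intro exI[of _ "max 147456 (nat \<lceil>1 / \<delta>\<rceil>)"] exI[of _ 1] exI[of _ 13] exI[of _ "\<lambda>n. n ^ 13"]) blast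
  qed
qed

end
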